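(* Let $g:\mathbb{R}\to\mathbb{R}$ be a measurable function such that $g(t)=0$ for all $t<0$ and $|g(t)|\le Ce^{-ct}$ for some constants $C>0$ and $c>0$, and let $\{Y_d(t)\}_{t\in\mathbb{R}}$ be the FIMA Stable process $$Y_d(t)=\int_{-\infty}^{t}(I_+^dg)(t-x)\,dL_\alpha(x),\quad t\in\mathbb{R}.$$ If $1<\alpha<2$ and $0<d<1-\frac1\alpha$, then $\{Y_d(t)\}_{t\in\mathbb{R}}$ has the property of long-range dependence (long memory), in the sense of the definition given in the context.
   Context: $\{L_\alpha(t)\}_{t\in\mathbb{R}}$ is a symmetric $\alpha$-stable ($S\alpha S$) process with index of stability $\alpha$ and Lebesgue control measure. The stable integral $f\mapsto\int_{\mathbb{R}}f\,dL_\alpha$ is the associated linear map from $L^\alpha(\mathbb{R})$ to random variables, with $\mathbb{E}[\exp\{i\theta\int_{\mathbb{R}} f\,dL_\alpha\}]=\exp\{-|\theta|^\alpha\int_{\mathbb{R}}|f(x)|^\alpha dx\}$ for $\theta\in\mathbb{R}$; and $\int_{-\infty}^tf\,dL_\alpha$ means $\int_{\mathbb{R}}\mathbf 1_{(-\infty,t]}f\,dL_\alpha$. The left-sided Riemann-Liouville fractional integral of order $d$ is $(I_+^dg)(x)=\frac1{\Gamma(d)}\int_{-\infty}^xg(t)(x-t)^{d-1}dt$. The process $Y_d$ is well defined and stationary. Definition of long-range dependence: let $\{X(t)\}_{t\in\mathbb{R}}$ be a stationary $S\alpha S$ process and, for $\theta_1,\theta_2\in\mathbb{R}$, let $$r(t)=r(\theta_1,\theta_2;t)=\mathbb{E}\big[e^{i(\theta_1X(t)+\theta_2X(0))}\big]-\mathbb{E}\big[e^{i\theta_1X(t)}\big]\,\mathbb{E}\big[e^{i\theta_2X(0)}\big].$$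 The process $\{X(t)\}_{t\in\mathbb{R}}$ has long-range dependence, or the long-memory property, if there exist $\theta\in(0,1)$ and a constant $c_r>0$ such that $r(t)$ satisfies $$\lim_{t\to\infty}|r(t)|\,\frac{t^{\theta}}{c_r}=1,$$ equivalently $|r(t)|\sim c_r t^{-\theta}$.
   Formalization: The formal theorem adds the hypothesis that the integral of g is nonzero; without it the claim fails (g = 0 gives r = 0, and any g with zero integral gives r(t) = o(1/t)). The power law is asserted for all nonzero θ1, θ2, since r vanishes if either is zero. *)

theory Defs
  imports "HOL-Probability.Probability"
begin

text \<open>
  \<open>L\<^sup>\<alpha>(\<real>)\<close> as a set of functions, not of equivalence classes; the stable
  integral below is accordingly linear only almost surely.
\<close>

definition L_space :: "real \<Rightarrow> (real \<Rightarrow> real) set" where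
  "L_space \<alpha> = {f \<in> borel_measurable lebesgue. integrable lebesgue (\<lambda>x. \<bar>f x\<bar> powr \<alpha>)}"

text \<open>
  \<open>L\<close> is symmetric \<open>\<alpha>\<close>-stable motion on the whole line, with Lebesgue control measure,
  and \<open>J f\<close> is (a version of) the stable integral of \<open>f\<close> with respect to \<open>L\<close>. The
  characteristic function of \<open>J (\<lambda>x. f x - h x)\<close> and the density of the step functions
  determine \<open>J\<close> from \<open>L\<close> up to almost sure equality.
\<close>

locale stable_integral = prob_space M for M :: "'w measure" +
  fixes \<alpha> :: real and L :: "real \<Rightarrow> 'w \<Rightarrow> real" and J :: "(real \<Rightarrow> real) \<Rightarrow> 'w \<Rightarrow> real"
  assumes index: "0 < \<alpha>" "\<alpha> \<le> 2"
    and L_measurable: "\<And>t. L t \<in> borel_measurable M"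
    and L_zero: "AE w in M. L 0 w = 0"
    and L_indep_increments:
      "\<And>(u :: nat \<Rightarrow> real) n. mono_on {..n} u \<Longrightarrow>
         indep_vars (\<lambda>_. borel) (\<lambda>i w. L (u (Suc i)) w - L (u i) w) {..<n}"
    and L_increments:
      "\<And>s t \<theta>. s \<le> t \<Longrightarrow>
         (CLINT w|M. iexp (\<theta> * (L t w - L s w))) = of_real (exp (- (t - s) * \<bar>\<theta>\<bar> powr \<alpha>))"
    and J_measurable: "\<And>f. f \<in> L_space \<alpha> \<Longrightarrow> J f \<in> borel_measurable M"
    and J_linear:
      "\<And>f h a b. f \<in> L_space \<alpha> \<Longrightarrow> h \<in> L_space \<alpha> \<Longrightarrow>
         AE w in M. J (\<lambda>x. a * f x + b * h x) w = a * J f w + b * J h w"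
    and J_char:
      "\<And>f \<theta>. f \<in> L_space \<alpha> \<Longrightarrow>
         (CLINT w|M. iexp (\<theta> * J f w))
           = of_real (exp (- (\<bar>\<theta>\<bar> powr \<alpha>) * (LINT x|lebesgue. \<bar>f x\<bar> powr \<alpha>)))"
    and J_interval:
      "\<And>s t. s \<le> t \<Longrightarrow> AE w in M. J (indicator {s<..t}) w = L t w - L s w"

definition frac_integral :: "real \<Rightarrow> (real \<Rightarrow> real) \<Rightarrow> real \<Rightarrow> real" where
  "frac_integral d g x = 1 / Gamma d * (LINT t:{..x}|lebesgue. g t * (x - t) powr (d - 1))"

definition FIMA :: "((real \<Rightarrow> real) \<Rightarrow> 'w \<Rightarrow> real) \<Rightarrow> real \<Rightarrow> (real \<Rightarrow> real) \<Rightarrow> real \<Rightarrow> 'w \<Rightarrow> real" where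
  "FIMA J d g t = J (\<lambda>x. indicator {..t} x * frac_integral d g (t - x))"

definition SaS_process :: "'w measure \<Rightarrow> real \<Rightarrow> (real \<Rightarrow> 'w \<Rightarrow> real) \<Rightarrow> bool" where
  "SaS_process M \<alpha> X \<longleftrightarrow>
     (\<forall>t. X t \<in> borel_measurable M) \<and>
     (\<forall>(n :: nat) (a :: nat \<Rightarrow> real) (u :: nat \<Rightarrow> real). \<exists>\<sigma>\<ge>0. \<forall>\<theta>.
        (CLINT w|M. iexp (\<theta> * (\<Sum>i<n. a i * X (u i) w)))
          = of_real (exp (- (\<sigma> powr \<alpha>) * \<bar>\<theta>\<bar> powr \<alpha>)))"

definition stationary_process :: "'w measure \<Rightarrow> (real \<Rightarrow> 'w \<Rightarrow> real) \<Rightarrow> bool" where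
  "stationary_process M X \<longleftrightarrow>
     (\<forall>(n :: nat) (u :: nat \<Rightarrow> real) h.
        distr M (\<Pi>\<^sub>M i\<in>{..<n}. borel) (\<lambda>w. \<lambda>i\<in>{..<n}. X (u i + h) w)
          = distr M (\<Pi>\<^sub>M i\<in>{..<n}. borel) (\<lambda>w. \<lambda>i\<in>{..<n}. X (u i) w))"

definition dependence ::
    "'w measure \<Rightarrow> (real \<Rightarrow> 'w \<Rightarrow> real) \<Rightarrow> real \<Rightarrow> real \<Rightarrow> real \<Rightarrow> complex" where
  "dependence M X \<theta>1 \<theta>2 t =
     (CLINT w|M. iexp (\<theta>1 * X t w + \<theta>2 * X 0 w))
       - (CLINT w|M. iexp (\<theta>1 * X t w)) * (CLINT w|M. iexp (\<theta>2 * X 0 w))"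

text \<open>
  If \<open>\<theta>1 = 0\<close> or \<open>\<theta>2 = 0\<close> then \<open>dependence M X \<theta>1 \<theta>2\<close> vanishes identically for every
  process, so the power law is required for all nonzero \<open>\<theta>1\<close>, \<open>\<theta>2\<close>. The exponent belongs
  to the process; only the constant \<open>c\<^sub>r\<close> may depend on \<open>\<theta>1\<close> and \<open>\<theta>2\<close>.
\<close>

definition long_range_dependent :: "'w measure \<Rightarrow> real \<Rightarrow> (real \<Rightarrow> 'w \<Rightarrow> real) \<Rightarrow> bool" where
  "long_range_dependent M \<alpha> X \<longleftrightarrow>
     SaS_process M \<alpha> X \<and> stationary_process M X \<and>
     (\<exists>\<theta>\<in>{0<..<1}. \<forall>\<theta>1 \<theta>2. \<theta>1 \<noteq> 0 \<longrightarrow> \<theta>2 \<noteq> 0 \<longrightarrow>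
        (\<exists>c\<^sub>r>0. ((\<lambda>t. norm (dependence M X \<theta>1 \<theta>2 t) * (t powr \<theta> / c\<^sub>r)) \<longlongrightarrow> 1) at_top))"

end

theory Submission
  imports Defs "HOL-Real_Asymp.Real_Asymp"
begin

text \<open>
  Let \<open>F\<close> be the fractional integral of \<open>g\<close> and \<open>D u v = |u + v|\<^sup>\<alpha> - |u|\<^sup>\<alpha> - |v|\<^sup>\<alpha>\<close>. The
  characteristic function of the stable integral gives \<open>r(t) = exp (- K) (exp (- I(t)) - 1)\<close>, where
  \<open>K\<close> does not depend on \<open>t\<close> and \<open>I(t)\<close> is the integral of \<open>D (\<theta>1 F(t + x)) (\<theta>2 F(x))\<close> over
  \<open>x\<close>. Since \<open>x powr (1 - d) F(x)\<close> tends to a nonzero constant, the substitution \<open>x = t y\<close> and dominated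
  convergence show that \<open>t powr (\<alpha> (1 - d) - 1) I(t)\<close> converges. The limit is nonzero because, for \<open>\<alpha> > 1\<close>,
  \<open>D u v\<close> has the sign of \<open>u v\<close>. Hence \<open>r\<close> obeys a power law with exponent
  \<open>\<alpha> (1 - d) - 1\<close>, which lies between 0 and 1.
\<close>

text \<open>Domination is the delicate point. After rescaling, the second argument of D grows like
  \<open>y powr (d - 1)\<close> as y tends to 0, and its \<alpha>-th power is not integrable there
  because \<alpha> (1 - d) > 1. Hence the three terms of D cannot be estimated separately. The
  difference of the \<alpha>-th powers of |u + v| and |v| is of first order in u, so v enters only
  with the power \<alpha> - 1, and (1 - d) (\<alpha> - 1) < 1 makes this integrable at 0. At
  infinity the inequality \<alpha> (1 - d) > 1 works in favour of the proof. The constant in the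
  asymptotics of F is the integral of g divided by \<open>Gamma d\<close>. This is where the nonzero
  integral of g enters; for g = 0 the dependence vanishes identically and no power law can hold.
  Long-range dependence, as defined, includes stationarity as equality of finite-dimensional laws.
  Characteristic functions of linear combinations must therefore determine joint laws, which is
  derived from the one-dimensional uniqueness theorem.\<close>

section \<open>Characteristic functions determine finite-dimensional laws\<close>

text \<open>A weight that is at least 1 has a positive integral and can be normalised to a
  probability density. The law of \<open>X\<close> under this density has the weighted integral as
  its characteristic function, up to the normalising factor, so one-dimensional uniqueness
  applies.\<close>

lemma weighted_char_uniqueness:
  fixes X w :: "'a \<Rightarrow> real" and Y v :: "'b \<Rightarrow> real"
  assumes "prob_space M" "prob_space N"
    and [measurable]: "X \<in> borel_measurable M" "Y \<in> borel_measurable N"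
      "w \<in> borel_measurable M" "v \<in> borel_measurable N"
    and w: "\<And>x. 1 \<le> w x" "\<And>x. w x \<le> b" and v: "\<And>y. 1 \<le> v y" "\<And>y. v y \<le> b"
    and eq: "\<And>a. (CLINT x|M. w x *\<^sub>R iexp (a * X x)) = (CLINT y|N. v y *\<^sub>R iexp (a * Y y))"
    and A [measurable]: "A \<in> sets borel"
  shows "(LINT x|M. w x * indicator A (X x)) = (LINT y|N. v y * indicator A (Y y))"
proof -
  have law: "real_distribution (distr (density M (\<lambda>x. w x / (LINT x|M. w x))) borel X) \<and>
     char (distr (density M (\<lambda>x. w x / (LINT x|M. w x))) borel X) a
       = (CLINT x|M. w x *\<^sub>R iexp (a * X x)) / (LINT x|M. w x) \<and>
     measure (distr (density M (\<lambda>x. w x / (LINT x|M. w x))) borel X) A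
       = (LINT x|M. w x * indicator A (X x)) / (LINT x|M. w x) \<and> (LINT x|M. w x) \<ge> 1"
    if "prob_space M" and [measurable]: "X \<in> borel_measurable M" "w \<in> borel_measurable M"
      and w: "\<And>x. 1 \<le> w x" "\<And>x. w x \<le> b"
    for M :: "'c measure" and X w :: "'c \<Rightarrow> real" and a
  proof -
    interpret prob_space M by fact
    define c where "c = (LINT x|M. w x)"
    have int: "integrable M w"
      using w by (intro integrable_const_bound[where B=b]) (auto intro!: AE_I2, smt (verit))
    have c1: "1 \<le> c"
      using integral_mono[OF integrable_const int, of 1] w(1) by (simp add: c_def prob_space)
    have w0: "0 \<le> w x" for x using w(1)[of x] by simp
    let ?D = "density M (\<lambda>x. ennreal (w x / c))"
    have "emeasure ?D (space ?D) = ennreal (\<integral>x. w x / c \<partial>M)"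
      using int c1 w0 by (subst nn_integral_eq_integral[symmetric])
        (auto simp: emeasure_density intro!: nn_integral_cong)
    also have "(\<integral>x. w x / c \<partial>M) = 1" using c1 by (simp add: c_def)
    finally have "prob_space ?D" by (intro prob_spaceI) simp
    then interpret D: prob_space ?D .
    have 1: "real_distribution (distr ?D borel X)"
      using D.prob_space_distr[of X borel] 
      by (simp add: real_distribution_def real_distribution_axioms_def)
    have 2: "char (distr ?D borel X) a = (CLINT x|M. w x *\<^sub>R iexp (a * X x)) / c"
      unfolding char_def using c1 w0
      by (subst integral_distr) (auto simp: integral_density scaleR_conv_of_real simp flip: integral_divide_zero)
    have "measure (distr ?D borel X) A = (LINT x|distr ?D borel X. indicator A x)"
      using real_distribution.axioms(1)[OF 1] by (simp)
    also have "\<dots> = (LINT x|M. w x * indicator A (X x)) / c"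
      using c1 w0 by (subst integral_distr) (auto simp: integral_density simp flip: integral_divide_zero)
    finally show ?thesis using 1 2 c1 unfolding c_def by blast
  qed
  note 1 = law[OF assms(1,3,5) w] and 2 = law[OF assms(2,4,6) v]
  \<comment> \<open>At frequency 0 the hypothesis says that the two normalising factors
    agree.\<close>
  have c: "(LINT x|M. w x) = (LINT x|N. v x)"
    using eq[of 0] by (simp add: scaleR_conv_of_real)
  have "distr (density M (\<lambda>x. w x / (LINT x|M. w x))) borel X
      = distr (density N (\<lambda>x. v x / (LINT x|N. v x))) borel Y"
    using 1 2 eq c by (intro Levy_uniqueness) (auto simp: fun_eq_iff)
  then show ?thesis using 1 2 c by (smt (verit) divide_cancel_right)
qed


text \<open>\<open>Re (z * w x)\<close> is half the sum of \<open>z * w x\<close> and its conjugate,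
  and conjugation turns the frequency \<open>a\<close> into \<open>- a\<close>. So complex-weighted
  characteristic functions at both frequencies determine the one with a positive real
  weight.\<close>

lemma integral_two_plus_Re:
  fixes X :: "'a \<Rightarrow> real" and w :: "'a \<Rightarrow> complex"
  assumes "prob_space M" and [measurable]: "X \<in> borel_measurable M" "w \<in> borel_measurable M"
    and w: "\<And>x. norm (w x) \<le> 1" and z: "norm z = 1"
  shows "(CLINT x|M. (2 + Re (z * w x)) *\<^sub>R iexp (a * X x))
    = 2 * (CLINT x|M. iexp (a * X x)) + z / 2 * (CLINT x|M. w x * iexp (a * X x))
      + cnj (z / 2 * (CLINT x|M. w x * iexp (- a * X x)))"
proof -
  interpret prob_space M by fact
  have int: "integrable M (\<lambda>x. u x * iexp (a * X x))"
    if [measurable]: "u \<in> borel_measurable M" and u: "\<And>x. norm (u x) \<le> 1" for u a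
    using u by (intro integrable_const_bound[where B=1]) (auto simp: norm_mult)
  have int1: "integrable M (\<lambda>x. iexp (a * X x))"
    using int[of "\<lambda>_. 1"] by simp
  have int2: "integrable M (\<lambda>x. cnj (w x) * iexp (a * X x))"
    using int[of w "- a", THEN complex_integrable_cnj[THEN iffD2]] w by (simp add: exp_cnj)
  have "(CLINT x|M. (2 + Re (z * w x)) *\<^sub>R iexp (a * X x))
      = (CLINT x|M. 2 * iexp (a * X x) + z / 2 * (w x * iexp (a * X x))
           + cnj z / 2 * (cnj (w x) * iexp (a * X x)))"
    by (intro Bochner_Integration.integral_cong refl) (simp add: complex_eq_iff field_simps)
  also have "\<dots> = 2 * (CLINT x|M. iexp (a * X x)) + z / 2 * (CLINT x|M. w x * iexp (a * X x))
      + cnj z / 2 * (CLINT x|M. cnj (w x) * iexp (a * X x))"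
    using int[of w a] int2 int1 w by simp
  also have "(CLINT x|M. cnj (w x) * iexp (a * X x)) = (CLINT x|M. cnj (w x * iexp (- a * X x)))"
    by (intro Bochner_Integration.integral_cong refl) (simp add: exp_cnj)
  also have "\<dots> = cnj (CLINT x|M. w x * iexp (- a * X x))" by (rule Bochner_Integration.integral_cnj)
  finally show ?thesis by simp
qed

text \<open>
  A complex weight \<open>w\<close> of modulus at most 1 is reduced to the positive weights
  \<open>2 + Re w\<close> and \<open>2 + Im w\<close>, which are densities after normalisation.
\<close>

lemma weighted_char_uniqueness_complex:
  fixes X :: "'a \<Rightarrow> real" and Y :: "'b \<Rightarrow> real" and w :: "'a \<Rightarrow> complex" and v :: "'b \<Rightarrow> complex"
  assumes "prob_space M" "prob_space N"
    and X [measurable]: "X \<in> borel_measurable M" and Y [measurable]: "Y \<in> borel_measurable N"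
    and wm [measurable]: "w \<in> borel_measurable M" and vm [measurable]: "v \<in> borel_measurable N"
    and w: "\<And>x. norm (w x) \<le> 1" and v: "\<And>y. norm (v y) \<le> 1"
    and eq1: "\<And>a. (CLINT x|M. iexp (a * X x)) = (CLINT y|N. iexp (a * Y y))"
    and eq: "\<And>a. (CLINT x|M. w x * iexp (a * X x)) = (CLINT y|N. v y * iexp (a * Y y))"
    and A [measurable]: "A \<in> sets borel"
  shows "(CLINT x|M. w x * indicator A (X x)) = (CLINT y|N. v y * indicator A (Y y))"
proof -
  interpret M: prob_space M by fact
  interpret N: prob_space N by fact
  have real: "(LINT x|M. Re (z * w x) * indicator A (X x)) = (LINT y|N. Re (z * v y) * indicator A (Y y))"
    if z: "norm z = 1" for z
  proof -
    have intM: "integrable M f" if "f \<in> borel_measurable M" "\<And>x. norm (f x) \<le> 3" for f :: "'a \<Rightarrow> 'c::{banach,second_countable_topology}"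
      using that by (intro M.integrable_const_bound[where B=3]) auto
    have intN: "integrable N f" if "f \<in> borel_measurable N" "\<And>x. norm (f x) \<le> 3" for f :: "'b \<Rightarrow> 'c::{banach,second_countable_topology}"
      using that by (intro N.integrable_const_bound[where B=3]) auto
    have zw: "norm (z * w x) \<le> 1" and zv: "norm (z * v y) \<le> 1" for x y
      using z w v by (auto simp: norm_mult)
    have bw: "\<bar>Re (z * w x)\<bar> \<le> 1" and bv: "\<bar>Re (z * v y)\<bar> \<le> 1" for x y
      using zw[of x] zv[of y] abs_Re_le_cmod order_trans by blast+
    have "(LINT x|M. (2 + Re (z * w x)) * indicator A (X x)) = (LINT y|N. (2 + Re (z * v y)) * indicator A (Y y))"
    proof (rule weighted_char_uniqueness[where b=3])
      show "1 \<le> 2 + Re (z * w x)" "2 + Re (z * w x) \<le> 3" for x using bw[of x] by auto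
      show "1 \<le> 2 + Re (z * v x)" "2 + Re (z * v x) \<le> 3" for x using bv[of x] by auto
      show "(CLINT x|M. (2 + Re (z * w x)) *\<^sub>R iexp (a * X x)) = (CLINT x|N. (2 + Re (z * v x)) *\<^sub>R iexp (a * Y x))" for a
        unfolding integral_two_plus_Re[OF assms(1) X wm w z] integral_two_plus_Re[OF assms(2) Y vm v z] eq1 eq ..
    qed (use assms(1,2) in simp_all)
    \<comment> \<open>The constant weight 2 is covered by \<open>eq1\<close> alone; subtracting it
      leaves the integral of the real part.\<close>
    moreover have "(LINT x|M. 2 * indicator A (X x) :: real) = (LINT y|N. 2 * indicator A (Y y))"
      by (rule weighted_char_uniqueness[where b=2]) 
        (use assms(1,2) eq1 in \<open>simp_all add: integral_scaleR_right\<close>)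
    moreover have "(LINT x|M. (2 + Re (z * w x)) * indicator A (X x))
        = (LINT x|M. 2 * indicator A (X x)) + (LINT x|M. Re (z * w x) * indicator A (X x))"
      unfolding distrib_right using bw
      by (intro Bochner_Integration.integral_add intM) 
        (measurable, auto simp del: times_complex.sel simp: indicator_def intro: order_trans[of _ 1])
    moreover have "(LINT x|N. (2 + Re (z * v x)) * indicator A (Y x))
        = (LINT x|N. 2 * indicator A (Y x)) + (LINT x|N. Re (z * v x) * indicator A (Y x))"
      unfolding distrib_right using bv
      by (intro Bochner_Integration.integral_add intN) 
        (measurable, auto simp del: times_complex.sel simp: indicator_def intro: order_trans[of _ 1])
    ultimately show ?thesis by simp
  qed
  have "integrable M (\<lambda>x. w x * indicator A (X x))" 
    using w by (intro M.integrable_const_bound[where B=1]) (auto simp: indicator_def norm_mult)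
  moreover have "integrable N (\<lambda>x. v x * indicator A (Y x))" 
    using v by (intro N.integrable_const_bound[where B=1]) (auto simp: indicator_def norm_mult)
  \<comment> \<open>The choices \<open>z = 1\<close> and \<open>z = - \<i>\<close> recover the real
    and the imaginary part.\<close>
  moreover have "Re (w x * indicator A (X x)) = Re (1 * w x) * indicator A (X x)" 
     "Im (w x * indicator A (X x)) = Re (- \<i> * w x) * indicator A (X x)" for x
    by (auto simp: indicator_def)
  moreover have "Re (v x * indicator A (Y x)) = Re (1 * v x) * indicator A (Y x)" 
     "Im (v x * indicator A (Y x)) = Re (- \<i> * v x) * indicator A (Y x)" for x
    by (auto simp: indicator_def)
  ultimately show ?thesis 
    using real[of 1] real[of "-\<i>"]
    by (simp only: complex_eq_iff integral_Re[symmetric] integral_Im[symmetric]) simp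
qed


text \<open>
  The factors \<open>iexp (a i * X i)\<close> are exchanged one at a time for indicators of \<open>X i\<close>; the
  remaining factors form the weight to which one-dimensional uniqueness applies.
\<close>

lemma finite_dim_char_uniqueness:
  fixes X :: "nat \<Rightarrow> 'a \<Rightarrow> real" and Y :: "nat \<Rightarrow> 'b \<Rightarrow> real"
  assumes "prob_space M" "prob_space N"
    and X [measurable]: "\<And>i. X i \<in> borel_measurable M" and Y [measurable]: "\<And>i. Y i \<in> borel_measurable N"
    and eq: "\<And>a. (CLINT x|M. iexp (\<Sum>i<n. a i * X i x)) = (CLINT y|N. iexp (\<Sum>i<n. a i * Y i y))"
  shows "distr M (\<Pi>\<^sub>M i\<in>{..<n}. borel) (\<lambda>x. \<lambda>i\<in>{..<n}. X i x)
    = distr N (\<Pi>\<^sub>M i\<in>{..<n}. borel) (\<lambda>y. \<lambda>i\<in>{..<n}. Y i y)"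
proof -
  interpret M: prob_space M by fact
  interpret N: prob_space N by fact
  have step: "(CLINT x|M. (\<Prod>i<k. indicator (A i) (X i x)) * iexp (\<Sum>i\<in>{k..<n}. a i * X i x))
      = (CLINT y|N. (\<Prod>i<k. indicator (A i) (Y i y)) * iexp (\<Sum>i\<in>{k..<n}. a i * Y i y))"
    if "k \<le> n" and A [measurable]: "\<And>i. A i \<in> sets borel" for k a A
    using that(1)
  proof (induction k arbitrary: a)
    case 0
    show ?case using eq[of a] by (simp add: lessThan_atLeast0)
  next
    case (Suc k)
    let ?W = "\<lambda>(Z :: nat \<Rightarrow> _ \<Rightarrow> real) x. (\<Prod>i<k. indicator (A i) (Z i x)) * iexp (\<Sum>i\<in>{Suc k..<n}. a i * Z i x)"
    have bound: "norm (?W Z x) \<le> 1" for Z :: "nat \<Rightarrow> 'c \<Rightarrow> real" and x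
      by (auto simp: norm_mult prod_norm[symmetric] indicator_def intro!: prod_le_1)
    have single: "(\<Sum>i<n. (if i = k then b else 0) * Z i x) = b * Z k x" for b :: real and Z :: "nat \<Rightarrow> 'c \<Rightarrow> real" and x
      using Suc.prems by (simp add: if_distrib[of "\<lambda>u. u * _"] cong: if_cong)
    \<comment> \<open>The frequency \<open>b\<close> is absorbed as the \<open>k\<close>-th
      coefficient, which makes the induction hypothesis applicable; this is why it is stated for
      arbitrary \<open>a\<close>.\<close>
    have W: "?W Z x * iexp (b * Z k x)
        = (\<Prod>i<k. indicator (A i) (Z i x)) * iexp (\<Sum>i\<in>{k..<n}. (a(k := b)) i * Z i x)"
      for b and Z :: "nat \<Rightarrow> 'c \<Rightarrow> real" and x
      using Suc.prems
      by (simp add: sum.atLeast_Suc_lessThan[of k n] exp_add[symmetric] algebra_simps cong: sum.cong_simp)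
    have "(CLINT x|M. ?W X x * indicator (A k) (X k x)) = (CLINT y|N. ?W Y y * indicator (A k) (Y k y))"
    proof (rule weighted_char_uniqueness_complex[OF assms(1,2) X Y _ _ bound bound])
      show "(CLINT x|M. iexp (b * X k x)) = (CLINT y|N. iexp (b * Y k y))" for b
        using eq[of "\<lambda>i. if i = k then b else 0"] unfolding single .
      show "(CLINT x|M. ?W X x * iexp (b * X k x)) = (CLINT y|N. ?W Y y * iexp (b * Y k y))" for b
        unfolding W using Suc.prems by (intro Suc.IH) simp
    qed (simp_all)
    then show ?case
      by (simp add: mult_ac)
  qed
  have prob: "measure M {x \<in> space M. \<forall>i<n. X i x \<in> A i} = measure N {y \<in> space N. \<forall>i<n. Y i y \<in> A i}"
    if A [measurable]: "\<And>i. A i \<in> sets borel" for A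
  proof -
    have ind: "(\<Prod>i<n. indicator (A i) (Z i x)) = complex_of_real (indicator {x \<in> S. \<forall>i<n. Z i x \<in> A i} x)"
      if "x \<in> S" for Z :: "nat \<Rightarrow> 'c \<Rightarrow> real" and x and S
      using that by (auto simp: indicator_def)
    have "(CLINT x|M. complex_of_real (indicator {x \<in> space M. \<forall>i<n. X i x \<in> A i} x))
        = (CLINT x|M. \<Prod>i<n. indicator (A i) (X i x))"
      by (intro Bochner_Integration.integral_cong refl) (simp add: ind)
    also have "\<dots> = (CLINT y|N. \<Prod>i<n. indicator (A i) (Y i y))"
      using step[of n A "\<lambda>_. 0"] by simp
    also have "\<dots> = (CLINT y|N. complex_of_real (indicator {y \<in> space N. \<forall>i<n. Y i y \<in> A i} y))"
      by (intro Bochner_Integration.integral_cong refl) (simp add: ind)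
    finally show ?thesis
      unfolding integral_complex_of_real by simp
  qed
  let ?P = "\<Pi>\<^sub>M i\<in>{..<n}. (borel :: real measure)"
  have Xm: "(\<lambda>x. \<lambda>i\<in>{..<n}. X i x) \<in> measurable M ?P" and Ym: "(\<lambda>y. \<lambda>i\<in>{..<n}. Y i y) \<in> measurable N ?P"
    by measurable
  show ?thesis
  proof (rule measure_eqI_PiM_finite[where I="{..<n}" and M="\<lambda>_. borel" and A="\<lambda>_. space ?P"])
    fix A :: "nat \<Rightarrow> real set"
    assume A: "\<And>i. i \<in> {..<n} \<Longrightarrow> A i \<in> sets borel"
    \<comment> \<open>\<open>prob\<close> asks for a Borel set at every index, whereas
      \<open>A\<close> is known to be Borel only below \<open>n\<close>.\<close>
    define B where "B i = (if i < n then A i else {})" for i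
    have B: "B i \<in> sets borel" for i using A by (auto simp: B_def)
    have PiE: "Pi\<^sub>E {..<n} A \<in> sets ?P" using A by (intro sets_PiM_I_finite) auto
    have pre: "(\<lambda>x. \<lambda>i\<in>{..<n}. Z i x) -` Pi\<^sub>E {..<n} A \<inter> S = {x \<in> S. \<forall>i<n. Z i x \<in> B i}"
      for Z :: "nat \<Rightarrow> 'c \<Rightarrow> real" and S
      unfolding B_def set_eq_iff vimage_eq Int_iff mem_Collect_eq PiE_iff
      by (simp add: extensional_def restrict_def) blast
    show "distr M ?P (\<lambda>x. \<lambda>i\<in>{..<n}. X i x) (Pi\<^sub>E {..<n} A)
        = distr N ?P (\<lambda>y. \<lambda>i\<in>{..<n}. Y i y) (Pi\<^sub>E {..<n} A)"
      using prob[of B, OF B] PiE Xm Ym pre[of X "space M"] pre[of Y "space N"]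
      by (simp add: emeasure_distr M.emeasure_eq_measure N.emeasure_eq_measure)
  next
    show "range (\<lambda>_::nat. space ?P) \<subseteq> prod_algebra {..<n} (\<lambda>_. borel)"
      using prod_algebraI_finite[of "{..<n}" "\<lambda>_. UNIV" "\<lambda>_. borel"] by (auto simp: space_PiM)
    show "distr M ?P (\<lambda>x. \<lambda>i\<in>{..<n}. X i x) (space ?P) \<noteq> \<infinity>"
      using Xm by (simp add: emeasure_distr M.emeasure_eq_measure)
  qed simp_all
qed

section \<open>The defect of additivity of the \<alpha>-th power\<close>

text \<open>For the kernels of two stable integrals, the integral of this expression is the
  logarithm of the product of the marginal characteristic functions over the joint one, the
  generalised codifference.\<close>

definition power_defect :: "real \<Rightarrow> real \<Rightarrow> real \<Rightarrow> real" where
  "power_defect \<alpha> u v = \<bar>u + v\<bar> powr \<alpha> - \<bar>u\<bar> powr \<alpha> - \<bar>v\<bar> powr \<alpha>"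

lemma power_defect_scale: "power_defect \<alpha> (s * u) (s * v) = \<bar>s\<bar> powr \<alpha> * power_defect \<alpha> u v"
proof -
  have "\<bar>s * u + s * v\<bar> = \<bar>s\<bar> * \<bar>u + v\<bar>" by (simp add: distrib_left[symmetric] abs_mult)
  then show ?thesis by (simp add: power_defect_def abs_mult powr_mult right_diff_distrib)
qed

lemma abs_powr_diff_le:
  fixes a b \<alpha> :: real
  assumes \<alpha>: "1 \<le> \<alpha>" and "0 \<le> a" "a \<le> b"
  shows "b powr \<alpha> - a powr \<alpha> \<le> \<alpha> * (b - a) * b powr (\<alpha> - 1)"
\<comment> \<open>The mean value theorem is used with a derivative at both end points, and at 0 the
  power need not have one of the required form.\<close>
proof (cases "a = b \<or> a = 0")
  case True
  then show ?thesis
  proof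
    assume "a = 0"
    have "1 * (b * b powr (\<alpha> - 1)) \<le> \<alpha> * (b * b powr (\<alpha> - 1))"
      using assms by (intro mult_right_mono) auto
    moreover have "b * b powr (\<alpha> - 1) = b powr \<alpha>"
      using assms by (cases "b = 0") (auto simp: powr_mult_base)
    ultimately show ?thesis using \<open>a = 0\<close> \<alpha> by (simp add: mult.assoc)
  qed simp
next
  case False
  with assms have ab: "0 < a" "a < b" by auto
  have "\<exists>z. a < z \<and> z < b \<and> b powr \<alpha> - a powr \<alpha> = (b - a) * (\<alpha> * z powr (\<alpha> - 1))"
    using ab by (intro MVT2) (auto intro!: derivative_eq_intros)
  then obtain z where z: "a < z" "z < b" "b powr \<alpha> - a powr \<alpha> = (b - a) * (\<alpha> * z powr (\<alpha> - 1))"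
    by blast
  have "(b - a) * (\<alpha> * z powr (\<alpha> - 1)) \<le> (b - a) * (\<alpha> * b powr (\<alpha> - 1))"
    using z ab \<alpha> by (intro mult_left_mono powr_mono2) auto
  then show ?thesis using z by (simp add: mult_ac)
qed

text \<open>The asymmetry is deliberate: \<open>u\<close> occurs linearly and \<open>v\<close> only
  with the power \<alpha> - 1. The mean value theorem applied to |u + v| and |v| contributes the
  summand \<alpha> of the constant, the term \<open>\<bar>u\<bar> powr \<alpha>\<close> the summand
  1.\<close>

lemma power_defect_bound:
  assumes "1 \<le> \<alpha>"
  shows "\<bar>power_defect \<alpha> u v\<bar> \<le> (\<alpha> + 1) * \<bar>u\<bar> * (\<bar>u\<bar> + \<bar>v\<bar>) powr (\<alpha> - 1)"
proof -
  let ?s = "\<bar>u\<bar> + \<bar>v\<bar>"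
  have "\<bar>\<bar>u + v\<bar> powr \<alpha> - \<bar>v\<bar> powr \<alpha>\<bar> \<le> \<alpha> * \<bar>u\<bar> * ?s powr (\<alpha> - 1)"
  proof (cases "\<bar>v\<bar> \<le> \<bar>u + v\<bar>")
    case True
    have "\<bar>u + v\<bar> powr \<alpha> - \<bar>v\<bar> powr \<alpha> \<le> \<alpha> * (\<bar>u + v\<bar> - \<bar>v\<bar>) * \<bar>u + v\<bar> powr (\<alpha> - 1)"
      using True assms by (intro abs_powr_diff_le) auto
    also have "\<dots> \<le> \<alpha> * \<bar>u\<bar> * ?s powr (\<alpha> - 1)"
      using True assms by (intro mult_mono powr_mono2) auto
    finally show ?thesis using powr_mono2[of \<alpha> "\<bar>v\<bar>" "\<bar>u + v\<bar>"] True assms by auto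
  next
    case False
    have "\<bar>v\<bar> powr \<alpha> - \<bar>u + v\<bar> powr \<alpha> \<le> \<alpha> * (\<bar>v\<bar> - \<bar>u + v\<bar>) * \<bar>v\<bar> powr (\<alpha> - 1)"
      using False assms by (intro abs_powr_diff_le) auto
    also have "\<dots> \<le> \<alpha> * \<bar>u\<bar> * ?s powr (\<alpha> - 1)"
      using False assms by (intro mult_mono powr_mono2) auto
    finally show ?thesis using powr_mono2[of \<alpha> "\<bar>u + v\<bar>" "\<bar>v\<bar>"] False assms by auto
  qed
  moreover have "\<bar>u\<bar> powr \<alpha> \<le> \<bar>u\<bar> * ?s powr (\<alpha> - 1)"
  proof -
    have "\<bar>u\<bar> powr \<alpha> = \<bar>u\<bar> * \<bar>u\<bar> powr (\<alpha> - 1)"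
      by (cases "u = 0") (auto simp: powr_mult_base)
    also have "\<dots> \<le> \<bar>u\<bar> * ?s powr (\<alpha> - 1)"
      using assms by (intro mult_left_mono powr_mono2) auto
    finally show ?thesis .
  qed
  moreover have "\<bar>a - x - y\<bar> \<le> p + q" if "\<bar>a - y\<bar> \<le> p" "x \<le> q" "0 \<le> x" for a x y p q :: real
    using that by linarith
  ultimately have "\<bar>power_defect \<alpha> u v\<bar> \<le> \<alpha> * \<bar>u\<bar> * ?s powr (\<alpha> - 1) + \<bar>u\<bar> * ?s powr (\<alpha> - 1)"
    unfolding power_defect_def using powr_ge_zero by blast
  then show ?thesis by (simp add: algebra_simps)
qed

lemma powr_add_superadditive:
  fixes u v \<alpha> :: real
  assumes "1 < \<alpha>" "0 < u" "0 < v"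
  shows "u powr \<alpha> + v powr \<alpha> < (u + v) powr \<alpha>"
proof -
  have "u * u powr (\<alpha> - 1) < u * (u + v) powr (\<alpha> - 1)" "v * v powr (\<alpha> - 1) < v * (u + v) powr (\<alpha> - 1)"
    using assms by (auto intro!: powr_less_mono2)
  then have "u * u powr (\<alpha> - 1) + v * v powr (\<alpha> - 1) < (u + v) * (u + v) powr (\<alpha> - 1)"
    by (simp add: distrib_right)
  then show ?thesis using assms by (simp add: powr_mult_base)
qed

lemma power_defect_pos:
  assumes "1 < \<alpha>" "0 < u * v"
  shows "0 < power_defect \<alpha> u v"
proof -
  have "\<bar>u + v\<bar> = \<bar>u\<bar> + \<bar>v\<bar>" "u \<noteq> 0" "v \<noteq> 0" using assms(2) by (auto simp: zero_less_mult_iff)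
  then show ?thesis
    using powr_add_superadditive[of \<alpha> "\<bar>u\<bar>" "\<bar>v\<bar>"] assms by (simp add: power_defect_def)
qed

text \<open>Opposite signs make |u + v| smaller than the larger of the two moduli, so monotonicity
  of the power suffices.\<close>

lemma power_defect_neg:
  assumes "0 < \<alpha>" "u * v < 0"
  shows "power_defect \<alpha> u v < 0"
proof -
  have uv: "\<bar>u + v\<bar> < max \<bar>u\<bar> \<bar>v\<bar>" "u \<noteq> 0" "v \<noteq> 0" using assms(2) by (auto simp: mult_less_0_iff)
  then have "\<bar>u + v\<bar> powr \<alpha> < max \<bar>u\<bar> \<bar>v\<bar> powr \<alpha>" using assms by (intro powr_less_mono2) auto
  also have "\<dots> \<le> \<bar>u\<bar> powr \<alpha> + \<bar>v\<bar> powr \<alpha>" by (auto simp: max_def)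
  finally show ?thesis by (simp add: power_defect_def)
qed

lemma tendsto_power_defect:
  assumes "0 < \<alpha>" "(f \<longlongrightarrow> u) F" "(h \<longlongrightarrow> v) F"
  shows "((\<lambda>x. power_defect \<alpha> (f x) (h x)) \<longlongrightarrow> power_defect \<alpha> u v) F"
  unfolding power_defect_def using assms
  by (intro tendsto_diff tendsto_powr2 tendsto_rabs tendsto_add tendsto_const) auto

lemma borel_measurable_power_defect [measurable (raw)]:
  assumes "f \<in> borel_measurable M" "h \<in> borel_measurable M"
  shows "(\<lambda>x. power_defect \<alpha> (f x) (h x)) \<in> borel_measurable M"
  unfolding power_defect_def using assms by measurable

section \<open>Bounds and asymptotics of the fractional integral\<close>

lemma powr_reflect_integral:
  fixes d x :: real
  assumes d: "0 < d" and x: "0 \<le> x"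
  shows "set_integrable lebesgue {0..x} (\<lambda>t. (x - t) powr (d - 1))"
    and "(LINT t:{0..x}|lebesgue. (x - t) powr (d - 1)) = x powr d / d"
proof -
  have "((\<lambda>t. (x - t) powr (d - 1)) has_integral (- ((x - x) powr d / d) - - ((x - 0) powr d / d))) {0..x}"
  \<comment> \<open>For d < 1 the integrand is unbounded near t = x, so the derivative is taken in
    the open interval only.\<close>
  proof (rule fundamental_theorem_of_calculus_interior[OF x])
    show "continuous_on {0..x} (\<lambda>t. - ((x - t) powr d / d))"
      using d by (intro continuous_intros continuous_on_powr') auto
    show "((\<lambda>t. - ((x - t) powr d / d)) has_vector_derivative (x - t) powr (d - 1)) (at t)"
      if "t \<in> {0<..<x}" for t
      unfolding has_real_derivative_iff_has_vector_derivative[symmetric]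
      using that d by (auto intro!: derivative_eq_intros)
  qed
  then have I: "((\<lambda>t. (x - t) powr (d - 1)) has_integral (x powr d / d)) {0..x}" using d by simp
  then show 1: "set_integrable lebesgue {0..x} (\<lambda>t. (x - t) powr (d - 1))"
    by (intro nonnegative_absolutely_integrable_1) (auto simp: has_integral_iff)
  show "(LINT t:{0..x}|lebesgue. (x - t) powr (d - 1)) = x powr d / d"
    using I set_lebesgue_integral_eq_integral(2)[OF 1] by (simp add: has_integral_iff)
qed

lemma exp_minus_integral:
  fixes c :: real
  assumes "0 < c"
  shows "set_integrable lebesgue {0..} (\<lambda>t. exp (- c * t))"
    and "(LINT t:{0..}|lebesgue. exp (- c * t)) = 1 / c"
proof -
  have I: "((\<lambda>t. exp (- c * t)) has_integral (1 / c)) {0..}"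
    using has_integral_exp_minus_to_infinity[OF assms, of 0] by simp
  then show 1: "set_integrable lebesgue {0..} (\<lambda>t. exp (- c * t))"
    by (intro nonnegative_absolutely_integrable_1) (auto simp: has_integral_iff)
  show "(LINT t:{0..}|lebesgue. exp (- c * t)) = 1 / c"
    using I set_lebesgue_integral_eq_integral(2)[OF 1] by (simp add: has_integral_iff)
qed

lemma mult_exp_minus_le:
  fixes c x :: real
  assumes "0 < c"
  shows "x * exp (- c * x) \<le> 1 / c"
proof -
  have "c * x \<le> exp (c * x)" using exp_ge_add_one_self[of "c * x"] by linarith
  then have "c * x * exp (- (c * x)) \<le> exp (c * x) * exp (- (c * x))"
    by (intro mult_right_mono) auto
  then show ?thesis using assms by (simp add: exp_minus_inverse field_simps exp_minus)
qed

lemma measurable_powr_reflect_lebesgue [measurable]: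
  "(\<lambda>t::real. (x - t) powr a) \<in> borel_measurable lebesgue"
  by (intro measurable_completion) measurable

lemma measurable_exp_lebesgue [measurable]:
  "(\<lambda>t::real. exp (a * t)) \<in> borel_measurable lebesgue"
  by (intro measurable_completion) measurable

lemma measurable_indicator_interval_lebesgue [measurable]:
  "(indicator {a..b::real} :: real \<Rightarrow> real) \<in> borel_measurable lebesgue"
  by (intro measurable_completion) measurable

locale exp_decay_function =
  fixes g :: "real \<Rightarrow> real" and C c d :: real
  assumes d: "0 < d" "d < 1"
    and g_measurable [measurable]: "g \<in> borel_measurable lebesgue"
    and g_zero: "\<And>t. t < 0 \<Longrightarrow> g t = 0"
    and C: "0 < C" and c: "0 < c"
    and g_bound: "\<And>t. \<bar>g t\<bar> \<le> C * exp (- c * t)"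
begin

abbreviation F :: "real \<Rightarrow> real" where "F \<equiv> frac_integral d g"

lemma Gamma_pos: "0 < Gamma d" using d by (intro Gamma_real_pos) auto

lemma F_eq: "F x = (LINT t|lebesgue. indicator {0..x} t * (g t * (x - t) powr (d - 1))) / Gamma d"
proof -
  have "(LINT t:{..x}|lebesgue. g t * (x - t) powr (d - 1))
      = (LINT t|lebesgue. indicator {0..x} t * (g t * (x - t) powr (d - 1)))"
    unfolding set_lebesgue_integral_def
    by (intro Bochner_Integration.integral_cong refl) (auto simp: indicator_def g_zero)
  then show ?thesis by (simp add: frac_integral_def)
qed

lemma F_zero: "x \<le> 0 \<Longrightarrow> F x = 0"
proof -
  assume x: "x \<le> 0"
  have "(LINT t|lebesgue. indicator {0..x} t * (g t * (x - t) powr (d - 1))) = 0"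
    by (intro integral_eq_zero_AE AE_I2) (use x d in \<open>auto simp: indicator_def\<close>)
  then show ?thesis by (simp add: F_eq)
qed

text \<open>\<open>g\<close> is only Lebesgue measurable. Replacing it by a Borel function that
  agrees almost everywhere changes \<open>F\<close> at no point, and then measurability of integrals
  depending on a parameter applies.\<close>

lemma F_measurable [measurable]: "F \<in> borel_measurable borel"
proof -
  obtain g' where g' [measurable]: "g' \<in> borel_measurable lborel" and eq: "AE t in lborel. g t = g' t"
    using completion_ex_borel_measurable_real[OF g_measurable] by blast
  have AE: "AE t in lebesgue. g t = g' t" using eq by (rule AE_completion)
  have "F x = (LINT t|lborel. indicator {0..x} t * (g' t * (x - t) powr (d - 1))) / Gamma d" for x
  proof -
    have [measurable]: "g' \<in> borel_measurable lebesgue" using g' by (rule measurable_completion)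
    have "(LINT t|lebesgue. indicator {0..x} t * (g t * (x - t) powr (d - 1)))
        = (LINT t|lebesgue. indicator {0..x} t * (g' t * (x - t) powr (d - 1)))"
    proof (rule integral_cong_AE)
      show "AE t in lebesgue. indicator {0..x} t * (g t * (x - t) powr (d - 1)) = indicator {0..x} t * (g' t * (x - t) powr (d - 1))"
        using AE by eventually_elim simp
    qed measurable
    also have "\<dots> = (LINT t|lborel. indicator {0..x} t * (g' t * (x - t) powr (d - 1)))"
      by (rule integral_completion) measurable
    finally show ?thesis by (simp add: F_eq)
  qed
  moreover have "(\<lambda>x. (LINT t|lborel. indicator {0..x} t * (g' t * (x - t) powr (d - 1))) / Gamma d) \<in> borel_measurable borel"
  proof -
    \<comment> \<open>Written with a condition, the indicator is visibly jointly measurable in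
      \<open>x\<close> and \<open>t\<close>.\<close>
    have "(\<lambda>x. (LINT t|lborel. (if 0 \<le> t \<and> t \<le> x then 1 else 0) * (g' t * (x - t) powr (d - 1))) / Gamma d) \<in> borel_measurable borel"
      by measurable
    then show ?thesis by (simp add: indicator_def)
  qed
  ultimately show ?thesis by presburger
qed

text \<open>Two majorants with explicit integrals: \<open>a\<close> weighs the exponential decay of
  \<open>g\<close>, \<open>b\<close> the integrable singularity of the kernel at t = x. Each
  application sets one of them to 0.\<close>

lemma integral_bound:
  assumes x: "0 \<le> x" and A [measurable]: "A \<in> sets lebesgue" and sub: "A \<subseteq> {0..x}"
    and p: "\<And>t. t \<in> A \<Longrightarrow> \<bar>g t\<bar> * (x - t) powr (d - 1) \<le> a * exp (- c * t) + b * (x - t) powr (d - 1)"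
    and ab: "0 \<le> a" "0 \<le> b"
  shows "integrable lebesgue (\<lambda>t. indicator A t * (g t * (x - t) powr (d - 1)))"
    and "\<bar>LINT t|lebesgue. indicator A t * (g t * (x - t) powr (d - 1))\<bar> \<le> a / c + b * (x powr d / d)"
proof -
  let ?b = "\<lambda>t. a * (indicator {0..} t * exp (- c * t)) + b * (indicator {0..x} t * (x - t) powr (d - 1))"
  have b: "has_bochner_integral lebesgue ?b (a * (1 / c) + b * (x powr d / d))"
    using powr_reflect_integral[OF d(1) x] exp_minus_integral[OF c]
    by (intro has_bochner_integral_add has_bochner_integral_mult_right)
      (auto simp: has_bochner_integral_iff set_integrable_def set_lebesgue_integral_def)
  have le: "norm (indicator A t * (g t * (x - t) powr (d - 1))) \<le> ?b t" for t
    using p[of t] sub ab by (auto simp: indicator_def abs_mult)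
  show int: "integrable lebesgue (\<lambda>t. indicator A t * (g t * (x - t) powr (d - 1)))"
    using b by (rule Bochner_Integration.integrable_bound[OF integrable.intros])
      (measurable, use le in \<open>auto intro!: AE_I2 order_trans[OF _ abs_ge_self]\<close>)
  have "\<bar>LINT t|lebesgue. indicator A t * (g t * (x - t) powr (d - 1))\<bar> \<le> (LINT t|lebesgue. ?b t)"
    unfolding real_norm_def[symmetric]
    by (intro Bochner_Integration.integral_norm_bound_integral[OF int integrable.intros[OF b]] le)
  then show "\<bar>LINT t|lebesgue. indicator A t * (g t * (x - t) powr (d - 1))\<bar> \<le> a / c + b * (x powr d / d)"
    using has_bochner_integral_integral_eq[OF b] by simp
qed

text \<open>The summand with coefficient 0 gives the estimate the shape of the premise
  \<open>p\<close> of \<open>integral_bound\<close>.\<close>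

lemma g_powr_bound:
  assumes "0 \<le> t"
  shows "\<bar>g t\<bar> * (x - t) powr (d - 1) \<le> 0 * exp (- c * t) + C * (x - t) powr (d - 1)"
proof -
  have "c * t \<ge> 0" using assms c by simp
  then have "C * exp (- c * t) \<le> C * 1" using C by (intro mult_left_mono) auto
  then have "\<bar>g t\<bar> \<le> C" using g_bound[of t] by linarith
  then show ?thesis by (simp add: mult_right_mono)
qed

text \<open>Serves near 0, where a bound of order \<open>x powr (d - 1)\<close> fails to be in the
  \<alpha>-th power integrable class as soon as \<alpha> (1 - d) > 1.\<close>

lemma F_bound_small:
  assumes x: "0 \<le> x"
  shows "\<bar>F x\<bar> \<le> C / (d * Gamma d) * x powr d"
proof -
  have "\<bar>g t\<bar> * (x - t) powr (d - 1) \<le> 0 * exp (- c * t) + C * (x - t) powr (d - 1)" if "t \<in> {0..x}" for t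
    using that by (intro g_powr_bound) simp
  from integral_bound(2)[where A="{0..x}", OF x _ _ this] C
  have "\<bar>LINT t|lebesgue. indicator {0..x} t * (g t * (x - t) powr (d - 1))\<bar> \<le> C * (x powr d / d)"
    by simp
  then have "\<bar>F x\<bar> \<le> C * (x powr d / d) / Gamma d"
    unfolding F_eq abs_divide using Gamma_pos by (simp only: abs_of_pos divide_right_mono less_imp_le)
  then show ?thesis by (simp add: mult_ac)
qed

lemma integral_bound_far:
  assumes x: "0 < x"
  shows "\<bar>LINT t|lebesgue. indicator {x / 2<..x} t * (g t * (x - t) powr (d - 1))\<bar>
    \<le> C / d * x powr d * exp (- (c / 2) * x)"
proof -
  have "\<bar>g t\<bar> * (x - t) powr (d - 1) \<le> 0 * exp (- c * t) + (C * exp (- (c / 2) * x)) * (x - t) powr (d - 1)"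
    if "t \<in> {x / 2<..x}" for t
  proof -
    have "c * (x / 2) \<le> c * t" using that c by (intro mult_left_mono) auto
    then have "C * exp (- c * t) \<le> C * exp (- (c / 2) * x)" using C by (intro mult_left_mono) auto
    then have "\<bar>g t\<bar> \<le> C * exp (- (c / 2) * x)" using g_bound[of t] by linarith
    then show ?thesis by (simp add: mult_right_mono)
  qed
  moreover have "{x/2<..x} \<subseteq> {0..x}" using x by auto
  ultimately have "\<bar>LINT t|lebesgue. indicator {x / 2<..x} t * (g t * (x - t) powr (d - 1))\<bar>
      \<le> C * exp (- (c / 2) * x) * (x powr d / d)"
    using integral_bound(2)[where A="{x/2<..x}" and x=x and a=0 and b="C * exp (- (c / 2) * x)"] x C by simp
  then show ?thesis by (simp add: mult_ac)
qed

lemma powr_near_bound: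
  assumes x: "0 < x" and t: "0 \<le> t" "t \<le> x / 2"
  shows "(x - t) powr (d - 1) \<le> 2 * x powr (d - 1)"
proof -
  have "(x - t) powr (d - 1) \<le> (x / 2) powr (d - 1)"
    using assms d by (intro powr_mono2') auto
  also have "\<dots> = x powr (d - 1) * 2 powr (1 - d)"
    using x powr_minus_divide[of 2 "d - 1"] by (simp add: powr_divide)
  also have "\<dots> \<le> x powr (d - 1) * 2 powr 1"
    using d by (intro mult_left_mono powr_mono) auto
  finally show ?thesis by simp
qed

text \<open>The cut at x / 2 separates the bulk of \<open>g\<close>, near 0, from the singularity of
  the kernel at t = x. On the left the kernel is comparable to \<open>x powr (d - 1)\<close>; on the
  right \<open>g\<close> is exponentially small in \<open>x\<close>.\<close>

lemma integral_split:
  assumes x: "0 < x"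
  shows "Gamma d * F x = (LINT t|lebesgue. indicator {0..x/2} t * (g t * (x - t) powr (d - 1)))
     + (LINT t|lebesgue. indicator {x/2<..x} t * (g t * (x - t) powr (d - 1)))"
proof -
  have "integrable lebesgue (\<lambda>t. indicator {0..x/2} t * (g t * (x - t) powr (d - 1)))"
  proof (rule integral_bound(1)[where a=0 and b=C and x=x])
    show "\<bar>g t\<bar> * (x - t) powr (d - 1) \<le> 0 * exp (- c * t) + C * (x - t) powr (d - 1)" if "t \<in> {0..x/2}" for t
      using that x by (intro g_powr_bound) simp
  qed (use x C in auto)
  moreover have "integrable lebesgue (\<lambda>t. indicator {x/2<..x} t * (g t * (x - t) powr (d - 1)))"
  proof (rule integral_bound(1)[where a=0 and b=C and x=x])
    show "\<bar>g t\<bar> * (x - t) powr (d - 1) \<le> 0 * exp (- c * t) + C * (x - t) powr (d - 1)" if "t \<in> {x/2<..x}" for t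
      using that x by (intro g_powr_bound) simp
  qed (use x C in auto)
  moreover have "indicator {0..x} t * (g t * (x - t) powr (d - 1))
     = indicator {0..x/2} t * (g t * (x - t) powr (d - 1)) + indicator {x/2<..x} t * (g t * (x - t) powr (d - 1))" for t
    using x by (auto simp: indicator_def)
  ultimately show ?thesis using Gamma_pos by (simp add: F_eq)
qed

text \<open>The bound holds on the whole positive half-line and is homogeneous, so after the
  substitution x = t y and multiplication by \<open>t powr (1 - d)\<close> it no longer depends on
  t. This is what domination requires.\<close>

lemma F_bound_large: "\<exists>B>0. \<forall>x>0. \<bar>F x\<bar> \<le> B * x powr (d - 1)"
proof -
  \<comment> \<open>The first summand comes from t \<le> x / 2, the second from t > x / 2; the
    factor \<open>2 / c\<close> is \<open>mult_exp_minus_le\<close> at rate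
    \<open>c / 2\<close>.\<close>
  define B where "B = 2 * C / (c * Gamma d) + C / (d * Gamma d) * (2 / c)"
  have "\<bar>F x\<bar> \<le> B * x powr (d - 1)" if x: "0 < x" for x
  proof -
    have near: "\<bar>g t\<bar> * (x - t) powr (d - 1) \<le> (2 * C * x powr (d - 1)) * exp (- c * t) + 0 * (x - t) powr (d - 1)"
      if "t \<in> {0..x/2}" for t
    proof -
      have "\<bar>g t\<bar> * (x - t) powr (d - 1) \<le> (C * exp (- c * t)) * (2 * x powr (d - 1))"
        using g_bound[of t] powr_near_bound[OF x, of t] that C by (intro mult_mono) auto
      then show ?thesis by (simp add: mult_ac)
    qed
    have 1: "\<bar>LINT t|lebesgue. indicator {0..x/2} t * (g t * (x - t) powr (d - 1))\<bar> \<le> 2 * C * x powr (d - 1) / c"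
      using integral_bound(2)[where A="{0..x/2}", OF _ _ _ near] x C by auto
    have "x powr d * exp (- (c / 2) * x) = x powr (d - 1) * (x * exp (- (c / 2) * x))"
      using x by (simp add: powr_mult_base[symmetric] mult_ac powr_diff)
    also have "\<dots> \<le> x powr (d - 1) * (2 / c)"
      using mult_exp_minus_le[of "c/2" x] c by (intro mult_left_mono) auto
    finally have "C / d * (x powr d * exp (- (c / 2) * x)) \<le> C / d * (x powr (d - 1) * (2 / c))"
      using C d by (intro mult_left_mono) auto
    then have 2: "\<bar>LINT t|lebesgue. indicator {x / 2<..x} t * (g t * (x - t) powr (d - 1))\<bar>
      \<le> C / d * (x powr (d - 1) * (2 / c))"
      using integral_bound_far[OF x] by (simp add: mult.assoc)
    have "Gamma d * \<bar>F x\<bar> = \<bar>Gamma d * F x\<bar>" using Gamma_pos by (simp add: abs_mult)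
    also have "\<dots> \<le> 2 * C * x powr (d - 1) / c + C / d * (x powr (d - 1) * (2 / c))"
      using 1 2 unfolding integral_split[OF x] by linarith
    also have "\<dots> = Gamma d * (B * x powr (d - 1))"
      using Gamma_pos[THEN less_imp_neq, symmetric] d c by (simp add: B_def field_simps)
    finally show ?thesis using Gamma_pos by simp
  qed
  moreover have "0 < B" using C c d Gamma_pos by (auto simp: B_def intro!: add_pos_pos)
  ultimately show ?thesis by blast
qed

text \<open>Seen from far away, \<open>g\<close> acts like a point mass at 0 of size its integral:
  the normalised kernel tends to 1 for fixed t and is at most 2 for 0 \<le> t \<le> x / 2. The rest
  is exponentially small.\<close>

lemma F_asymp: "((\<lambda>x. x powr (1 - d) * F x) \<longlongrightarrow> (LINT t|lebesgue. g t) / Gamma d) at_top"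
proof -
  let ?near = "\<lambda>x t. indicator {0..x/2} t * (g t * ((x - t) / x) powr (d - 1))"
  let ?far = "\<lambda>x. LINT t|lebesgue. indicator {x / 2<..x} t * (g t * (x - t) powr (d - 1))"
  have 1: "((\<lambda>x. LINT t|lebesgue. ?near x t) \<longlongrightarrow> (LINT t|lebesgue. g t)) at_top"
  proof (rule integral_dominated_convergence_at_top[where w="\<lambda>t. 2 * C * (indicator {0..} t * exp (- c * t))"])
    show "(\<lambda>t. ?near x t) \<in> borel_measurable lebesgue" for x
      by (simp add: powr_divide) measurable
    show "integrable lebesgue (\<lambda>t. 2 * C * (indicator {0..} t * exp (- c * t)))"
      using exp_minus_integral(1)[OF c] by (simp add: set_integrable_def)
    show "\<forall>\<^sub>F x in at_top. AE t in lebesgue. norm (?near x t) \<le> 2 * C * (indicator {0..} t * exp (- c * t))"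
      using eventually_gt_at_top[of 0]
    proof eventually_elim
      case (elim x)
      have "norm (?near x t) \<le> 2 * C * (indicator {0..} t * exp (- c * t))" for t
      proof (cases "t \<in> {0..x/2}")
        case True
        then have "((x - t) / x) powr (d - 1) \<le> 2"
          using powr_near_bound[OF elim, of t] elim by (simp add: powr_divide divide_simps)
        then have "\<bar>g t\<bar> * ((x - t) / x) powr (d - 1) \<le> (C * exp (- c * t)) * 2"
          using g_bound[of t] C by (intro mult_mono) auto
        then show ?thesis using True by (simp add: abs_mult mult_ac)
      qed (use C in \<open>auto simp: indicator_def\<close>)
      then show ?case by blast
    qed
    show "AE t in lebesgue. ((\<lambda>x. ?near x t) \<longlongrightarrow> g t) at_top"
    proof (intro AE_I2)
      fix t :: real
      show "((\<lambda>x. ?near x t) \<longlongrightarrow> g t) at_top"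
      proof (cases "t < 0")
        case False
        have "((\<lambda>x. (x - t) / x) \<longlongrightarrow> 1) at_top" by real_asymp
        then have "((\<lambda>x. g t * ((x - t) / x) powr (d - 1)) \<longlongrightarrow> g t * 1 powr (d - 1)) at_top"
          by (intro tendsto_intros) auto
        moreover have "\<forall>\<^sub>F x in at_top. ?near x t = g t * ((x - t) / x) powr (d - 1)"
          using eventually_ge_at_top[of "2 * t"] by eventually_elim (use False in auto)
        ultimately show ?thesis by (simp only: powr_one_eq_one mult_1_right filterlim_cong[OF refl refl])
      qed (use g_zero in simp)
    qed
  qed measurable
  have "((\<lambda>x. C / d * (x * exp (- (c / 2) * x))) \<longlongrightarrow> C / d * 0) at_top"
    using c by (intro tendsto_intros) real_asymp
  then have lim: "((\<lambda>x. C / d * (x * exp (- (c / 2) * x))) \<longlongrightarrow> 0) at_top" by simp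
  have 2: "((\<lambda>x. x powr (1 - d) * ?far x) \<longlongrightarrow> 0) at_top"
  proof (rule Lim_null_comparison[OF _ lim])
    show "\<forall>\<^sub>F x in at_top. norm (x powr (1 - d) * ?far x) \<le> C / d * (x * exp (- (c / 2) * x))"
      using eventually_gt_at_top[of 0]
    proof eventually_elim
      case (elim x)
      have "norm (x powr (1 - d) * ?far x) \<le> x powr (1 - d) * (C / d * x powr d * exp (- (c / 2) * x))"
        unfolding real_norm_def abs_mult abs_of_nonneg[OF powr_ge_zero]
        by (rule mult_left_mono[OF integral_bound_far[OF elim]]) simp
      also have "\<dots> = C / d * ((x powr (1 - d) * x powr d) * exp (- (c / 2) * x))"
        by (simp add: mult_ac)
      also have "x powr (1 - d) * x powr d = x" using elim by (simp add: powr_add[symmetric])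
      finally show ?case .
    qed
  qed
  have "((\<lambda>x. ((LINT t|lebesgue. ?near x t) + x powr (1 - d) * ?far x) / Gamma d) \<longlongrightarrow> ((LINT t|lebesgue. g t) + 0) / Gamma d) at_top"
    using 1 2 Gamma_pos by (intro tendsto_intros) auto
  moreover have "\<forall>\<^sub>F x in at_top. x powr (1 - d) * F x = ((LINT t|lebesgue. ?near x t) + x powr (1 - d) * ?far x) / Gamma d"
    using eventually_gt_at_top[of 0]
  proof eventually_elim
    case (elim x)
    have "x powr (1 - d) * (LINT t|lebesgue. indicator {0..x/2} t * (g t * (x - t) powr (d - 1))) = (LINT t|lebesgue. ?near x t)"
      unfolding integral_mult_right_zero[symmetric]
    proof (intro Bochner_Integration.integral_cong refl)
      fix t
      have "((x - t) / x) powr (d - 1) = x powr (1 - d) * (x - t) powr (d - 1)" if "t \<le> x / 2"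
        using elim that by (simp add: powr_divide powr_minus_divide[of x "d - 1", simplified] )
      then show "x powr (1 - d) * (indicator {0..x/2} t * (g t * (x - t) powr (d - 1))) = ?near x t"
        by (auto simp: indicator_def)
    qed
    moreover have "Gamma d * F x * x powr (1 - d) = x powr (1 - d) * F x * Gamma d" by simp
    ultimately show ?case using integral_split[OF elim] Gamma_pos by (simp add: field_simps)
  qed
  ultimately show ?thesis by (simp only: add_0_right filterlim_cong[OF refl refl])
qed

end

section \<open>Scaling limit of the integrated defect\<close>

lemma integrable_lborel_powr_from_0:
  assumes "- 1 < (p::real)"
  shows "integrable lborel (\<lambda>y. indicator {0..1} y * y powr p)"
proof -
  have "set_integrable lebesgue {0..1} (\<lambda>y. y powr p)"
    using assms by (intro nonnegative_absolutely_integrable_1 integrable_on_powr_from_0) auto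
  then show ?thesis unfolding set_integrable_def by (subst (asm) integrable_completion) auto
qed

lemma integrable_lborel_powr_to_inf:
  assumes "(q::real) < - 1"
  shows "integrable lborel (\<lambda>y. indicator {1..} y * y powr q)"
proof -
  have "(\<lambda>y. y powr q) integrable_on {1..}"
    using has_integral_powr_to_inf[OF assms, of 1] by (auto simp: integrable_on_def)
  then have "set_integrable lebesgue {1..} (\<lambda>y. y powr q)"
    by (intro nonnegative_absolutely_integrable_1) auto
  then show ?thesis unfolding set_integrable_def by (subst (asm) integrable_completion) auto
qed

text \<open>If the integral of this nonnegative function vanished, the function would be 0 almost
  everywhere and the unit interval would be a null set.\<close>

lemma integral_pos_half_line:
  fixes f :: "real \<Rightarrow> real"
  assumes int: "integrable lborel f" and pos: "\<And>y. 0 < y \<Longrightarrow> 0 < f y" and zero: "\<And>y. y \<le> 0 \<Longrightarrow> f y = 0"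
  shows "0 < (LINT y|lborel. f y)"
proof -
  have nonneg: "0 \<le> f y" for y using pos[of y] zero[of y] by (cases "0 < y") auto
  have "(LINT y|lborel. f y) \<noteq> 0"
  proof
    assume "(LINT y|lborel. f y) = 0"
    then have "AE y in lborel. f y = 0"
      using integral_nonneg_eq_0_iff_AE[OF int] nonneg by simp
    then have "AE y in lborel. y \<notin> {0::real..1}"
      using AE_lborel_singleton[of 0]
    proof eventually_elim
      case (elim y)
      then show ?case using pos[of y] by (cases "0 < y") auto
    qed
    then have "emeasure lborel {0::real..1} = 0"
      by (subst (asm) AE_iff_measurable[where N="{0..1}"]) auto
    then show False by simp
  qed
  then show ?thesis using Bochner_Integration.integral_nonneg[of lborel f] nonneg by (simp add: less_le)
qed

locale long_memory_kernel = exp_decay_function +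
  fixes \<alpha> :: real
  assumes \<alpha>: "1 < \<alpha>" "\<alpha> < 2" and d_less: "d < 1 - 1 / \<alpha>"
    and mass: "(LINT t|lebesgue. g t) \<noteq> 0"
begin

text \<open>The lower bound restates d < 1 - 1 / \<alpha>; it makes \<open>F\<close> integrable to
  the power \<alpha> at infinity and the memory exponent positive. The upper bound keeps that
  exponent below 1.\<close>

lemma exponent: "1 < \<alpha> * (1 - d)" "\<alpha> * (1 - d) < 2"
proof -
  have "1 / \<alpha> < 1 - d" using d_less by linarith
  then show "1 < \<alpha> * (1 - d)" using \<alpha> by (simp add: divide_less_eq mult.commute)
  have "\<alpha> * (1 - d) < \<alpha> * 1" using \<alpha> d by (intro mult_strict_left_mono) auto
  then show "\<alpha> * (1 - d) < 2" using \<alpha> by linarith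
qed

text \<open>The limit in \<open>F_asymp\<close>: the leading coefficient of \<open>F\<close> at
  infinity.\<close>

definition \<kappa> :: real where
  "\<kappa> = (LINT t|lebesgue. g t) / Gamma d"

lemma \<kappa>_nonzero: "\<kappa> \<noteq> 0"
  using mass Gamma_pos by (simp add: \<kappa>_def)

text \<open>Near 0 only the second argument of the defect is singular, with the power \<alpha> - 1;
  near infinity both arguments have order \<open>y powr (d - 1)\<close> and the full power \<alpha>
  appears.\<close>

definition envelope :: "real \<Rightarrow> real" where
  "envelope y = indicator {0..1} y * y powr ((d - 1) * (\<alpha> - 1)) + indicator {1..} y * y powr ((d - 1) * \<alpha>)"

lemma integrable_envelope: "integrable lborel envelope"
proof -
  have "(1 - d) * (\<alpha> - 1) < 1 * 1" using d \<alpha> by (intro mult_strict_mono) auto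
  then have "- 1 < (d - 1) * (\<alpha> - 1)" by (simp add: algebra_simps)
  moreover have "(d - 1) * \<alpha> < - 1" using exponent by (simp add: algebra_simps)
  ultimately show ?thesis unfolding envelope_def
    by (intro Bochner_Integration.integrable_add integrable_lborel_powr_from_0 integrable_lborel_powr_to_inf)
qed

text \<open>The linear place in \<open>power_defect_bound\<close> goes to the argument controlled by
  \<open>1 + y\<close>, which stays bounded as y tends to 0.\<close>

lemma power_defect_envelope:
  assumes y: "0 < y" and u: "\<bar>u\<bar> \<le> m * (1 + y) powr (d - 1)" and v: "\<bar>v\<bar> \<le> m * y powr (d - 1)" and m: "0 \<le> m"
  shows "\<bar>power_defect \<alpha> u v\<bar> \<le> (\<alpha> + 1) * m * (2 * m) powr (\<alpha> - 1) * envelope y"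
proof -
  have le: "(1 + y) powr (d - 1) \<le> y powr (d - 1)" using y d by (intro powr_mono2') auto
  then have "m * (1 + y) powr (d - 1) \<le> m * y powr (d - 1)" using m by (intro mult_left_mono)
  then have s: "\<bar>u\<bar> + \<bar>v\<bar> \<le> 2 * m * y powr (d - 1)" using u v by linarith
  have env: "(1 + y) powr (d - 1) * y powr ((d - 1) * (\<alpha> - 1)) \<le> envelope y"
  proof (cases "y < 1")
    case True
    have "(1 + y) powr (d - 1) \<le> (1 + y) powr 0" using y d by (intro powr_mono) auto
    then have "(1 + y) powr (d - 1) * y powr ((d - 1) * (\<alpha> - 1)) \<le> 1 * y powr ((d - 1) * (\<alpha> - 1))"
      using y by (intro mult_right_mono) auto
    then show ?thesis using True y by (simp add: envelope_def)
  next
    case False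
    have "(1 + y) powr (d - 1) * y powr ((d - 1) * (\<alpha> - 1)) \<le> y powr (d - 1) * y powr ((d - 1) * (\<alpha> - 1))"
      using le by (intro mult_right_mono) auto
    also have "\<dots> = y powr ((d - 1) + (d - 1) * (\<alpha> - 1))" by (simp only: powr_add)
    also have "\<dots> = y powr ((d - 1) * \<alpha>)"
      by (rule arg_cong[where f="(powr) y"]) (simp add: algebra_simps)
    also have "\<dots> \<le> envelope y" using False by (simp add: envelope_def)
    finally show ?thesis .
  qed
  have "\<bar>power_defect \<alpha> u v\<bar> \<le> (\<alpha> + 1) * \<bar>u\<bar> * (\<bar>u\<bar> + \<bar>v\<bar>) powr (\<alpha> - 1)"
    using \<alpha> by (intro power_defect_bound) auto
  also have "\<dots> \<le> (\<alpha> + 1) * (m * (1 + y) powr (d - 1)) * (2 * m * y powr (d - 1)) powr (\<alpha> - 1)"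
    using u s \<alpha> m by (intro mult_mono powr_mono2) auto
  also have "\<dots> = (\<alpha> + 1) * m * (2 * m) powr (\<alpha> - 1) * ((1 + y) powr (d - 1) * y powr ((d - 1) * (\<alpha> - 1)))"
    unfolding powr_mult[of "2 * m" "y powr (d - 1)"] powr_powr by (simp only: mult_ac)
  also have "\<dots> \<le> (\<alpha> + 1) * m * (2 * m) powr (\<alpha> - 1) * envelope y"
    using env \<alpha> m by (intro mult_left_mono) auto
  finally show ?thesis .
qed

text \<open>The pointwise limit of the rescaled defect. For y \<le> 0 it is 0 even when 1 + y > 0,
  because \<open>F (t * y)\<close> vanishes and a defect with a zero argument is 0.\<close>

definition limit_kernel :: "real \<Rightarrow> real \<Rightarrow> real \<Rightarrow> real" where
  "limit_kernel a b y = (if 0 < y then power_defect \<alpha>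
     (a * \<kappa> * (1 + y) powr (d - 1))
     (b * \<kappa> * y powr (d - 1)) else 0)"

lemma limit_kernel_measurable [measurable]: "limit_kernel a b \<in> borel_measurable borel"
  unfolding limit_kernel_def by measurable

lemma integrable_limit_kernel: "integrable lborel (limit_kernel a b)"
proof -
  define m where "m = max \<bar>a * \<kappa>\<bar> \<bar>b * \<kappa>\<bar>"
  have m: "0 \<le> m" "\<bar>a * \<kappa>\<bar> \<le> m" "\<bar>b * \<kappa>\<bar> \<le> m"
    unfolding m_def by (simp_all only: le_max_iff_disj abs_ge_zero order_refl simp_thms)
  have "norm (limit_kernel a b y) \<le> (\<alpha> + 1) * m * (2 * m) powr (\<alpha> - 1) * envelope y" for y
  proof (cases "0 < y")
    case True
    have "\<bar>a * \<kappa> * (1 + y) powr (d - 1)\<bar> \<le> m * (1 + y) powr (d - 1)" 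
      "\<bar>b * \<kappa> * y powr (d - 1)\<bar> \<le> m * y powr (d - 1)"
      unfolding abs_mult[of _ "_ powr _"] abs_of_nonneg[OF powr_ge_zero] 
      using m by (auto intro!: mult_right_mono)
    from power_defect_envelope[OF True this m(1)] show ?thesis using True by (simp add: limit_kernel_def)
  next
    case False
    then show ?thesis using \<alpha> m by (simp add: limit_kernel_def envelope_def)
  qed
  then have "AE y in lborel. norm (limit_kernel a b y) \<le> norm ((\<alpha> + 1) * m * (2 * m) powr (\<alpha> - 1) * envelope y)"
    by (intro AE_I2) (metis abs_ge_self order_trans real_norm_def)
  then show ?thesis
    by (rule Bochner_Integration.integrable_bound[OF integrable_mult_right[OF integrable_envelope], rotated]) simp
qed

text \<open>The product of the two arguments contains \<open>\<kappa>\<close> squared, so the kernel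
  has the sign of \<open>a * b\<close> on the whole positive half-line and nothing cancels in the
  integral.\<close>

lemma integral_limit_kernel_nonzero:
  assumes "a \<noteq> 0" "b \<noteq> 0"
  shows "(LINT y|lborel. limit_kernel a b y) \<noteq> 0"
proof -
  have prod: "(a * \<kappa> * (1 + y) powr (d - 1)) * (b * \<kappa> * y powr (d - 1))
      = (a * b) * (\<kappa>\<^sup>2 * ((1 + y) powr (d - 1) * y powr (d - 1)))" for y
    by (simp add: power2_eq_square)
  have pos: "0 < \<kappa>\<^sup>2 * ((1 + y) powr (d - 1) * y powr (d - 1))" if "0 < y" for y
    using \<kappa>_nonzero that by (intro mult_pos_pos) (auto simp: zero_less_power2)
  consider "0 < a * b" | "a * b < 0" using assms by (metis linorder_neqE_linordered_idom no_zero_divisors)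
  then show ?thesis
  proof cases
    case 1
    have "0 < (LINT y|lborel. limit_kernel a b y)"
      using integrable_limit_kernel
    proof (rule integral_pos_half_line)
      show "0 < limit_kernel a b y" if "0 < y" for y
        using mult_pos_pos[OF 1 pos[OF that]] that \<alpha> unfolding prod[symmetric]
        by (simp add: limit_kernel_def power_defect_pos)
    qed (simp add: limit_kernel_def)
    then show ?thesis by simp
  next
    case 2
    have "0 < (LINT y|lborel. - limit_kernel a b y)"
      using Bochner_Integration.integrable_minus[OF integrable_limit_kernel]
    proof (rule integral_pos_half_line)
      show "0 < - limit_kernel a b y" if "0 < y" for y
        using mult_neg_pos[OF 2 pos[OF that]] that \<alpha> unfolding prod[symmetric]
        by (simp add: limit_kernel_def power_defect_neg)
    qed (simp add: limit_kernel_def)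
    then show ?thesis by simp
  qed
qed

text \<open>
  The substitution \<open>x = t y\<close> and the homogeneity of the defect reduce the claim to dominated
  convergence.
\<close>

lemma power_defect_integral_asymp:
  "((\<lambda>t. t powr (\<alpha> * (1 - d) - 1) * (LINT x|lborel. power_defect \<alpha> (a * F (t + x)) (b * F x)))
     \<longlongrightarrow> (LINT y|lborel. limit_kernel a b y)) at_top"
proof -
  \<comment> \<open>Each argument carries \<open>t powr (1 - d)\<close>, the factor under which
    \<open>F (t * z)\<close> converges. Homogeneity turns these into
    \<open>t powr (\<alpha> * (1 - d))\<close>, and the Jacobian of x = t y takes away one power of
    t.\<close>
  define s where "s t y = power_defect \<alpha> (a * (t powr (1 - d) * F (t * (1 + y)))) (b * (t powr (1 - d) * F (t * y)))" for t y
  have "((\<lambda>t. LINT y|lborel. s t y) \<longlongrightarrow> (LINT y|lborel. limit_kernel a b y)) at_top"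
  proof -
    obtain B where B: "0 < B" "\<And>x. 0 < x \<Longrightarrow> \<bar>F x\<bar> \<le> B * x powr (d - 1)" using F_bound_large by blast
    \<comment> \<open>\<open>power_defect_envelope\<close> wants one constant for both
      arguments.\<close>
    define m where "m = max \<bar>a\<bar> \<bar>b\<bar> * B"
    have m: "0 \<le> m" "\<bar>a\<bar> * B \<le> m" "\<bar>b\<bar> * B \<le> m" using B by (auto simp: m_def)
    have scaled: "\<bar>e * (t powr (1 - d) * F (t * z))\<bar> \<le> m * z powr (d - 1)"
      if "0 < t" "0 < z" "\<bar>e\<bar> * B \<le> m" for e t z
    proof -
      have "\<bar>e * (t powr (1 - d) * F (t * z))\<bar> = \<bar>e\<bar> * (t powr (1 - d) * \<bar>F (t * z)\<bar>)" by (simp add: abs_mult)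
      also have "\<dots> \<le> \<bar>e\<bar> * (t powr (1 - d) * (B * (t * z) powr (d - 1)))"
        using that B by (intro mult_left_mono) auto
      also have "\<dots> = (\<bar>e\<bar> * B) * ((t powr (1 - d) * t powr (d - 1)) * z powr (d - 1))"
        using that by (simp add: powr_mult)
      also have "t powr (1 - d) * t powr (d - 1) = 1" using that by (simp add: powr_add[symmetric])
      also have "(\<bar>e\<bar> * B) * (1 * z powr (d - 1)) \<le> m * z powr (d - 1)"
        using that by (simp add: mult_right_mono)
      finally show ?thesis .
    qed
    have lim: "((\<lambda>t. t powr (1 - d) * F (t * z)) \<longlongrightarrow> \<kappa> * z powr (d - 1)) at_top" if z: "0 < z" for z
    proof -
      have "filterlim (\<lambda>t. t * z) at_top at_top"
        using z by real_asymp
      then have "((\<lambda>t. (t * z) powr (1 - d) * F (t * z)) \<longlongrightarrow> \<kappa>) at_top"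
        by (rule filterlim_compose[OF F_asymp[folded \<kappa>_def]])
      then have "((\<lambda>t. z powr (d - 1) * ((t * z) powr (1 - d) * F (t * z))) \<longlongrightarrow> z powr (d - 1) * \<kappa>) at_top"
        by (rule tendsto_mult[OF tendsto_const])
      moreover have "\<forall>\<^sub>F t in at_top. z powr (d - 1) * ((t * z) powr (1 - d) * F (t * z)) = t powr (1 - d) * F (t * z)"
        using eventually_gt_at_top[of 0]
      proof eventually_elim
        case (elim t)
        have "z powr (d - 1) * z powr (1 - d) = 1" using z by (simp add: powr_add[symmetric])
        then show ?case using elim z by (simp add: powr_mult)
      qed
      ultimately show ?thesis by (simp only: filterlim_cong[OF refl refl] mult.commute[of \<kappa>])
    qed
    show ?thesis
    proof (rule integral_dominated_convergence_at_top[where w="\<lambda>y. (\<alpha> + 1) * m * (2 * m) powr (\<alpha> - 1) * envelope y"])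
      show "(\<lambda>y. s t y) \<in> borel_measurable lborel" for t unfolding s_def by measurable
      show "integrable lborel (\<lambda>y. (\<alpha> + 1) * m * (2 * m) powr (\<alpha> - 1) * envelope y)"
        by (intro integrable_mult_right integrable_envelope)
      show "\<forall>\<^sub>F t in at_top. AE y in lborel. norm (s t y) \<le> (\<alpha> + 1) * m * (2 * m) powr (\<alpha> - 1) * envelope y"
        using eventually_gt_at_top[of 0]
      proof eventually_elim
        case (elim t)
        have "norm (s t y) \<le> (\<alpha> + 1) * m * (2 * m) powr (\<alpha> - 1) * envelope y" for y
        proof (cases "0 < y")
          case True
          then show ?thesis unfolding s_def real_norm_def
            using elim m by (intro power_defect_envelope scaled) auto
        next
          case False
          then have "F (t * y) = 0" using elim by (intro F_zero) (simp add: mult_nonneg_nonpos)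
          then show ?thesis using \<alpha> m by (simp add: s_def envelope_def power_defect_def)
        qed
        then show ?case by blast
      qed
      show "AE y in lborel. ((\<lambda>t. s t y) \<longlongrightarrow> limit_kernel a b y) at_top"
      proof (intro AE_I2)
        fix y :: real
        show "((\<lambda>t. s t y) \<longlongrightarrow> limit_kernel a b y) at_top"
        proof (cases "0 < y")
          case True
          have "((\<lambda>t. e * (t powr (1 - d) * F (t * z))) \<longlongrightarrow> e * \<kappa> * z powr (d - 1)) at_top" if "0 < z" for e z
            unfolding mult.assoc[of e] by (intro tendsto_mult[OF tendsto_const] lim that)
          then have "((\<lambda>t. s t y) \<longlongrightarrow> power_defect \<alpha> (a * \<kappa> * (1 + y) powr (d - 1)) (b * \<kappa> * y powr (d - 1))) at_top"
            unfolding s_def using \<alpha> True by (intro tendsto_power_defect) auto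
          then show ?thesis using True by (simp only: limit_kernel_def if_True)
        next
          case False
          have "\<forall>\<^sub>F t in at_top. s t y = limit_kernel a b y"
            using eventually_gt_at_top[of 0]
          proof eventually_elim
            case (elim t)
            then have "F (t * y) = 0" using False by (intro F_zero) (simp add: mult_nonneg_nonpos)
            then show ?case using \<alpha> False by (simp add: s_def limit_kernel_def power_defect_def)
          qed
          then show ?thesis by (rule tendsto_eventually)
        qed
      qed
    qed measurable
  qed
  moreover have "\<forall>\<^sub>F t in at_top. (LINT y|lborel. s t y)
      = t powr (\<alpha> * (1 - d) - 1) * (LINT x|lborel. power_defect \<alpha> (a * F (t + x)) (b * F x))"
    using eventually_gt_at_top[of 0]
  proof eventually_elim
    case (elim t)
    have "s t y = t powr (\<alpha> * (1 - d)) * power_defect \<alpha> (a * F (t + t * y)) (b * F (t * y))" for y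
      using power_defect_scale[of \<alpha> "t powr (1 - d)" "a * F (t + t * y)" "b * F (t * y)"]
      by (simp add: s_def powr_powr distrib_left mult_ac)
    moreover have "t powr (\<alpha> * (1 - d)) = t powr (\<alpha> * (1 - d) - 1) * t"
      using elim by (simp add: powr_diff)
    moreover have "(LINT x|lborel. power_defect \<alpha> (a * F (t + x)) (b * F x))
        = t * (LINT y|lborel. power_defect \<alpha> (a * F (t + t * y)) (b * F (t * y)))"
      using elim by (subst lborel_integral_real_affine[where c=t and t=0]) auto
    ultimately show ?case by simp
  qed
  ultimately show ?thesis by (simp only: filterlim_cong[OF refl refl])
qed

end

section \<open>Linear combinations of stable integrals\<close>

lemma abs_add_powr_le:
  fixes x y \<alpha> :: real
  assumes "0 \<le> \<alpha>"
  shows "\<bar>x + y\<bar> powr \<alpha> \<le> 2 powr \<alpha> * (\<bar>x\<bar> powr \<alpha> + \<bar>y\<bar> powr \<alpha>)"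
proof -
  have "\<bar>x + y\<bar> powr \<alpha> \<le> (2 * max \<bar>x\<bar> \<bar>y\<bar>) powr \<alpha>" using assms by (intro powr_mono2) auto
  also have "\<dots> = 2 powr \<alpha> * max \<bar>x\<bar> \<bar>y\<bar> powr \<alpha>" by (simp add: powr_mult)
  also have "\<dots> \<le> 2 powr \<alpha> * (\<bar>x\<bar> powr \<alpha> + \<bar>y\<bar> powr \<alpha>)" by (intro mult_left_mono) (auto simp: max_def)
  finally show ?thesis .
qed

lemma L_space_linear:
  assumes \<alpha>: "0 \<le> \<alpha>" and f: "f \<in> L_space \<alpha>" and h: "h \<in> L_space \<alpha>"
  shows "(\<lambda>x. a * f x + b * h x) \<in> L_space \<alpha>"
proof -
  have [measurable]: "f \<in> borel_measurable lebesgue" "h \<in> borel_measurable lebesgue"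
    using f h by (auto simp: L_space_def)
  let ?w = "\<lambda>x. 2 powr \<alpha> * (\<bar>a\<bar> powr \<alpha> * \<bar>f x\<bar> powr \<alpha> + \<bar>b\<bar> powr \<alpha> * \<bar>h x\<bar> powr \<alpha>)"
  have "integrable lebesgue ?w"
    using f h by (auto simp: L_space_def)
  moreover have "norm (\<bar>a * f x + b * h x\<bar> powr \<alpha>) \<le> norm (?w x)" for x
    using abs_add_powr_le[OF \<alpha>, of "a * f x" "b * h x"] by (simp add: abs_mult powr_mult)
  moreover have "(\<lambda>x. \<bar>a * f x + b * h x\<bar> powr \<alpha>) \<in> borel_measurable lebesgue" by measurable
  ultimately have "integrable lebesgue (\<lambda>x. \<bar>a * f x + b * h x\<bar> powr \<alpha>)"
    using Bochner_Integration.integrable_bound[OF _ _ AE_I2] by blast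
  then show ?thesis by (simp add: L_space_def)
qed

lemma L_space_zero: "(\<lambda>_. 0) \<in> L_space \<alpha>"
  by (simp add: L_space_def)

context stable_integral
begin

lemma J_sum:
  fixes f :: "nat \<Rightarrow> real \<Rightarrow> real"
  assumes "\<And>i. f i \<in> L_space \<alpha>"
  shows "(\<lambda>x. \<Sum>i<n. a i * f i x) \<in> L_space \<alpha> \<and>
    (AE w in M. J (\<lambda>x. \<Sum>i<n. a i * f i x) w = (\<Sum>i<n. a i * J (f i) w))"
proof (induction n)
  case 0
  \<comment> \<open>Linearity with both coefficients 0 says that \<open>J\<close> of the zero
    function is 0 almost surely.\<close>
  show ?case using J_linear[OF L_space_zero L_space_zero, of 0 0] by (simp add: L_space_zero)
next
  case (Suc n)
  let ?S = "\<lambda>x. \<Sum>i<n. a i * f i x"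
  have "(\<lambda>x. 1 * ?S x + a n * f n x) \<in> L_space \<alpha>"
    using index Suc.IH assms by (intro L_space_linear) auto
  moreover have "AE w in M. J (\<lambda>x. 1 * ?S x + a n * f n x) w = 1 * J ?S w + a n * J (f n) w"
    using Suc.IH assms by (intro J_linear) auto
  ultimately show ?case using Suc.IH by (auto elim!: eventually_elim2)
qed

lemma char_sum:
  fixes f :: "nat \<Rightarrow> real \<Rightarrow> real"
  assumes f: "\<And>i. f i \<in> L_space \<alpha>"
  shows "(CLINT w|M. iexp (\<theta> * (\<Sum>i<n. a i * J (f i) w)))
    = of_real (exp (- (\<bar>\<theta>\<bar> powr \<alpha>) * (LINT x|lebesgue. \<bar>\<Sum>i<n. a i * f i x\<bar> powr \<alpha>)))"
proof -
  have [measurable]: "J (f i) \<in> borel_measurable M" for i using f by (rule J_measurable)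
  have S: "(\<lambda>x. \<Sum>i<n. a i * f i x) \<in> L_space \<alpha>"
    and AE: "AE w in M. J (\<lambda>x. \<Sum>i<n. a i * f i x) w = (\<Sum>i<n. a i * J (f i) w)"
    using J_sum[where f=f and n=n and a=a] f by auto
  have [measurable]: "J (\<lambda>x. \<Sum>i<n. a i * f i x) \<in> borel_measurable M" using S by (rule J_measurable)
  have "(CLINT w|M. iexp (\<theta> * (\<Sum>i<n. a i * J (f i) w))) = (CLINT w|M. iexp (\<theta> * J (\<lambda>x. \<Sum>i<n. a i * f i x) w))"
  proof (rule integral_cong_AE)
    show "AE w in M. iexp (\<theta> * (\<Sum>i<n. a i * J (f i) w)) = iexp (\<theta> * J (\<lambda>x. \<Sum>i<n. a i * f i x) w)"
      using AE by eventually_elim simp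
  qed measurable
  then show ?thesis using J_char[OF S] by simp
qed

lemma char_pair:
  assumes f: "f \<in> L_space \<alpha>" and h: "h \<in> L_space \<alpha>"
  shows "(CLINT w|M. iexp (a * J f w + b * J h w))
    = of_real (exp (- (LINT x|lebesgue. \<bar>a * f x + b * h x\<bar> powr \<alpha>)))"
  using char_sum[where f="\<lambda>i. if i = 0 then f else h" and \<theta>=1 and n=2 and a="\<lambda>i. if i = 0 then a else b"] assms
  by (simp add: numeral_2_eq_2)

lemma SaS_process_J:
  assumes f: "\<And>t. f t \<in> L_space \<alpha>"
  shows "SaS_process M \<alpha> (\<lambda>t. J (f t))"
  unfolding SaS_process_def
proof (intro conjI allI)
  show "J (f t) \<in> borel_measurable M" for t using f by (rule J_measurable)
  fix n :: nat and a u :: "nat \<Rightarrow> real"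
  let ?I = "LINT x|lebesgue. \<bar>\<Sum>i<n. a i * f (u i) x\<bar> powr \<alpha>"
  have "0 \<le> ?I" by (intro Bochner_Integration.integral_nonneg) auto
  \<comment> \<open>The scale parameter is \<open>?I powr (1 / \<alpha>)\<close>, the \<alpha>-norm
    of the combined kernel.\<close>
  then have "(?I powr (1 / \<alpha>)) powr \<alpha> = ?I" using index by (simp add: powr_powr)
  then show "\<exists>\<sigma>\<ge>0. \<forall>\<theta>. (CLINT w|M. iexp (\<theta> * (\<Sum>i<n. a i * J (f (u i)) w)))
      = of_real (exp (- (\<sigma> powr \<alpha>) * \<bar>\<theta>\<bar> powr \<alpha>))"
    using char_sum[where f="\<lambda>i. f (u i)" and n=n and a=a] f
    by (intro exI[of _ "?I powr (1 / \<alpha>)"]) (simp add: mult.commute)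
qed

end

lemma integral_lebesgue_eq_lborel:
  fixes f :: "real \<Rightarrow> real"
  assumes "f \<in> borel_measurable borel"
  shows "(LINT x|lebesgue. f x) = (LINT x|lborel. f x)"
  using assms by (intro integral_completion) simp

lemma integral_lborel_shift:
  fixes f :: "real \<Rightarrow> real"
  shows "(LINT x|lborel. f (t + x)) = (LINT x|lborel. f x)"
  using lborel_integral_real_affine[of 1 f t] by simp

lemma integral_lborel_reflect:
  fixes f :: "real \<Rightarrow> real"
  shows "(LINT x|lborel. f (t - x)) = (LINT x|lborel. f x)"
  using lborel_integral_real_affine[of "-1" f t] by simp

section \<open>The moving-average kernel\<close>

context long_memory_kernel
begin

text \<open>\<open>F_bound_small\<close> controls the unit interval and \<open>F_bound_large\<close>
  the rest, where the exponent (d - 1) \<alpha> is below -1.\<close>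

lemma integrable_F_powr: "integrable lborel (\<lambda>x. \<bar>F x\<bar> powr \<alpha>)"
proof -
  obtain B where B: "0 < B" "\<And>x. 0 < x \<Longrightarrow> \<bar>F x\<bar> \<le> B * x powr (d - 1)" using F_bound_large by blast
  define A where "A = C / (d * Gamma d)"
  have A: "0 \<le> A" using C d Gamma_pos by (simp add: A_def)
  \<comment> \<open>\<open>x powr 0\<close> is the constant 1 in the form of
    \<open>integrable_lborel_powr_from_0\<close>. Its value at x = 0 is 0, which is harmless since
    \<open>F\<close> vanishes there.\<close>
  let ?w = "\<lambda>x. A powr \<alpha> * (indicator {0..1} x * x powr 0) + B powr \<alpha> * (indicator {1..} x * x powr ((d - 1) * \<alpha>))"
  have "(d - 1) * \<alpha> < - 1" using exponent by (simp add: algebra_simps)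
  then have "integrable lborel ?w"
    by (intro Bochner_Integration.integrable_add integrable_mult_right
        integrable_lborel_powr_from_0 integrable_lborel_powr_to_inf) auto
  moreover have "norm (\<bar>F x\<bar> powr \<alpha>) \<le> norm (?w x)" for x
  proof -
    have "\<bar>F x\<bar> powr \<alpha> \<le> ?w x"
    proof -
      consider "x \<le> 0" | "0 < x" "x < 1" | "1 \<le> x" by linarith
      then show ?thesis
      proof cases
        case 1
        then show ?thesis using \<alpha> by (simp add: F_zero)
      next
        case 2
        have "\<bar>F x\<bar> \<le> A * x powr d" using F_bound_small[of x] 2 by (simp add: A_def)
        also have "\<dots> \<le> A * 1" using 2 d A by (intro mult_left_mono powr_le1) auto
        finally have "\<bar>F x\<bar> powr \<alpha> \<le> A powr \<alpha>" using \<alpha> by (intro powr_mono2) auto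
        then show ?thesis using 2 by simp
      next
        case 3
        have "\<bar>F x\<bar> powr \<alpha> \<le> (B * x powr (d - 1)) powr \<alpha>" using B 3 \<alpha> by (intro powr_mono2) auto
        also have "\<dots> = B powr \<alpha> * x powr ((d - 1) * \<alpha>)" by (simp add: powr_mult powr_powr)
        also have "\<dots> \<le> ?w x" using 3 by simp
        finally show ?thesis .
      qed
    qed
    then show ?thesis using abs_ge_self[of "?w x"] by (simp only: real_norm_def abs_of_nonneg[OF powr_ge_zero])
  qed
  moreover have "(\<lambda>x. \<bar>F x\<bar> powr \<alpha>) \<in> borel_measurable lborel" by measurable
  ultimately show ?thesis
    using Bochner_Integration.integrable_bound[OF _ _ AE_I2] by blast
qed

lemma shift_L_space: "(\<lambda>x. F (t - x)) \<in> L_space \<alpha>"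
proof -
  have "integrable lborel (\<lambda>x. \<bar>F (t - x)\<bar> powr \<alpha>)"
    using lborel_integrable_real_affine[OF integrable_F_powr, of "-1" t] by simp
  then have "integrable lebesgue (\<lambda>x. \<bar>F (t - x)\<bar> powr \<alpha>)"
    by (subst integrable_completion) measurable
  moreover have "(\<lambda>x. F (t - x)) \<in> borel_measurable lebesgue"
    by (intro measurable_completion) measurable
  ultimately show ?thesis by (simp add: L_space_def)
qed

text \<open>Since \<open>F\<close> vanishes for nonpositive arguments, the cut-off at
  \<open>t\<close> is built into the kernel; this exhibits the process as a moving average of
  translates of one function.\<close>

lemma FIMA_eq: "FIMA J d g = (\<lambda>t. J (\<lambda>x. F (t - x)))"
proof -
  have "indicator {..t} x * F (t - x) = F (t - x)" for t x
    by (auto simp: indicator_def F_zero)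
  then show ?thesis unfolding FIMA_def by presburger
qed

lemma integral_power_split:
  assumes "0 < t"
  shows "(LINT x|lborel. \<bar>a * F (t - x) + b * F (0 - x)\<bar> powr \<alpha>)
    = (LINT x|lborel. power_defect \<alpha> (a * F (t + x)) (b * F x))
      + \<bar>a\<bar> powr \<alpha> * (LINT x|lborel. \<bar>F x\<bar> powr \<alpha>) + \<bar>b\<bar> powr \<alpha> * (LINT x|lborel. \<bar>F x\<bar> powr \<alpha>)"
proof -
  have int: "integrable lborel (\<lambda>x. \<bar>F (t + x)\<bar> powr \<alpha>)"
    using lborel_integrable_real_affine[OF integrable_F_powr, of 1 t] by simp
  let ?s = "\<lambda>x. \<bar>a * F (t + x) + b * F x\<bar> powr \<alpha>"
  have "integrable lborel ?s"
  proof (rule Bochner_Integration.integrable_bound)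
    show "integrable lborel (\<lambda>x. 2 powr \<alpha> * (\<bar>a\<bar> powr \<alpha> * \<bar>F (t + x)\<bar> powr \<alpha> + \<bar>b\<bar> powr \<alpha> * \<bar>F x\<bar> powr \<alpha>))"
      using int integrable_F_powr by simp
    show "AE x in lborel. norm (?s x)
        \<le> norm (2 powr \<alpha> * (\<bar>a\<bar> powr \<alpha> * \<bar>F (t + x)\<bar> powr \<alpha> + \<bar>b\<bar> powr \<alpha> * \<bar>F x\<bar> powr \<alpha>))"
    proof (intro AE_I2)
      show "norm (?s x) \<le> norm (2 powr \<alpha> * (\<bar>a\<bar> powr \<alpha> * \<bar>F (t + x)\<bar> powr \<alpha> + \<bar>b\<bar> powr \<alpha> * \<bar>F x\<bar> powr \<alpha>))" for x
        using abs_add_powr_le[of \<alpha> "a * F (t + x)" "b * F x"] \<alpha> by (simp add: abs_mult powr_mult)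
    qed
  qed measurable
  then have "(LINT x|lborel. power_defect \<alpha> (a * F (t + x)) (b * F x))
      = (LINT x|lborel. ?s x) - \<bar>a\<bar> powr \<alpha> * (LINT x|lborel. \<bar>F (t + x)\<bar> powr \<alpha>) - \<bar>b\<bar> powr \<alpha> * (LINT x|lborel. \<bar>F x\<bar> powr \<alpha>)"
    using int integrable_F_powr by (simp add: power_defect_def abs_mult powr_mult)
  moreover have "(LINT x|lborel. \<bar>F (t + x)\<bar> powr \<alpha>) = (LINT x|lborel. \<bar>F x\<bar> powr \<alpha>)"
    by (rule integral_lborel_shift)
  \<comment> \<open>The reflection of x moves the support of the second kernel to the positive
    half-line, where the scaling limit is taken.\<close>
  moreover have "(LINT x|lborel. \<bar>a * F (t - x) + b * F (0 - x)\<bar> powr \<alpha>) = (LINT x|lborel. ?s x)"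
    using integral_lborel_reflect[of ?s 0] by simp
  ultimately show ?thesis by simp
qed

end

section \<open>The power law for the dependence function\<close>

text \<open>As \<open>p\<close> tends to infinity while \<open>p * I\<close> converges,
  \<open>I\<close> tends to 0. The difference quotient \<open>q\<close> of the exponential at 0 is
  continuous there with value 1, so the increment may be replaced by \<open>- I t\<close>.\<close>

lemma tendsto_exp_diff_asymp:
  fixes I p :: "real \<Rightarrow> real"
  assumes p: "filterlim p at_top at_top" and I: "((\<lambda>t. p t * I t) \<longlongrightarrow> l) at_top"
  shows "((\<lambda>t. p t * (exp (- I t) - 1)) \<longlongrightarrow> - l) at_top"
proof -
  obtain q where q: "\<And>z::real. exp z - exp 0 = q z * (z - 0)" "isCont q 0" "q 0 = 1"
    using DERIV_exp[of "0::real"] unfolding CARAT_DERIV by auto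
  have "((\<lambda>t. (p t * I t) * inverse (p t)) \<longlongrightarrow> l * 0) at_top"
    by (intro tendsto_mult I tendsto_inverse_0_at_top p)
  moreover have "\<forall>\<^sub>F t in at_top. (p t * I t) * inverse (p t) = I t"
    using filterlim_at_top_dense[THEN iffD1, OF p, rule_format, of 0] by eventually_elim simp
  ultimately have "(I \<longlongrightarrow> l * 0) at_top" by (rule Lim_transform_eventually)
  then have "((\<lambda>t. - I t) \<longlongrightarrow> - (l * 0)) at_top" by (rule tendsto_minus)
  then have "((\<lambda>t. - I t) \<longlongrightarrow> 0) at_top" by simp
  then have "((\<lambda>t. q (- I t)) \<longlongrightarrow> q 0) at_top" by (rule isCont_tendsto_compose[OF q(2)])
  then have "((\<lambda>t. - (p t * I t) * q (- I t)) \<longlongrightarrow> - l * q 0) at_top"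
    by (intro tendsto_mult tendsto_minus I)
  moreover have "p t * (exp (- I t) - 1) = - (p t * I t) * q (- I t)" for t
    using q(1)[of "- I t"] by simp
  ultimately show ?thesis using q(3) by simp
qed

locale fima = stable_integral M \<alpha> L J + long_memory_kernel g C c d \<alpha>
  for M :: "'w measure" and \<alpha> L J g C c d
begin

lemma FIMA_SaS: "SaS_process M \<alpha> (FIMA J d g)"
  unfolding FIMA_eq by (rule SaS_process_J[OF shift_L_space])

text \<open>A shift of time translates every kernel by the same amount, and translation invariance
  of Lebesgue measure leaves the joint characteristic function unchanged.\<close>

lemma FIMA_stationary: "stationary_process M (FIMA J d g)"
  unfolding stationary_process_def
proof (intro allI)
  fix n :: nat and u :: "nat \<Rightarrow> real" and h :: real
  show "distr M (\<Pi>\<^sub>M i\<in>{..<n}. borel) (\<lambda>w. \<lambda>i\<in>{..<n}. FIMA J d g (u i + h) w)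
      = distr M (\<Pi>\<^sub>M i\<in>{..<n}. borel) (\<lambda>w. \<lambda>i\<in>{..<n}. FIMA J d g (u i) w)"
    unfolding FIMA_eq
  proof (rule finite_dim_char_uniqueness[OF prob_space_axioms prob_space_axioms])
    show "J (\<lambda>x. F (u i + h - x)) \<in> borel_measurable M" "J (\<lambda>x. F (u i - x)) \<in> borel_measurable M" for i
      by (intro J_measurable shift_L_space)+
    fix a :: "nat \<Rightarrow> real"
    have char: "(CLINT w|M. iexp (\<Sum>i<n. a i * J (\<lambda>x. F (v i - x)) w))
        = of_real (exp (- (LINT x|lborel. \<bar>\<Sum>i<n. a i * F (v i - x)\<bar> powr \<alpha>)))" for v
    proof -
      have "(LINT x|lebesgue. \<bar>\<Sum>i<n. a i * F (v i - x)\<bar> powr \<alpha>) = (LINT x|lborel. \<bar>\<Sum>i<n. a i * F (v i - x)\<bar> powr \<alpha>)"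
        by (intro integral_lebesgue_eq_lborel) measurable
      then show ?thesis
        using char_sum[where f="\<lambda>i x. F (v i - x)" and \<theta>=1 and n=n and a=a, OF shift_L_space] by simp
    qed
    have "(LINT x|lborel. \<bar>\<Sum>i<n. a i * F (u i - x)\<bar> powr \<alpha>)
        = (LINT x|lborel. \<bar>\<Sum>i<n. a i * F (u i - (- h + x))\<bar> powr \<alpha>)"
      by (rule integral_lborel_shift[symmetric])
    also have "\<dots> = (LINT x|lborel. \<bar>\<Sum>i<n. a i * F (u i + h - x)\<bar> powr \<alpha>)"
      by (simp add: algebra_simps)
    finally show "(CLINT w|M. iexp (\<Sum>i<n. a i * J (\<lambda>x. F (u i + h - x)) w))
        = (CLINT w|M. iexp (\<Sum>i<n. a i * J (\<lambda>x. F (u i - x)) w))"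
      unfolding char by simp
  qed
qed

lemma dependence_FIMA:
  assumes t: "0 < t"
  shows "dependence M (FIMA J d g) a b t = of_real
    (exp (- (\<bar>a\<bar> powr \<alpha> + \<bar>b\<bar> powr \<alpha>) * (LINT x|lborel. \<bar>F x\<bar> powr \<alpha>))
      * (exp (- (LINT x|lborel. power_defect \<alpha> (a * F (t + x)) (b * F x))) - 1))"
proof -
  let ?N = "LINT x|lborel. \<bar>F x\<bar> powr \<alpha>"
  let ?I = "LINT x|lborel. power_defect \<alpha> (a * F (t + x)) (b * F x)"
  have "(LINT x|lebesgue. \<bar>a * F (t - x) + b * F (0 - x)\<bar> powr \<alpha>) = (LINT x|lborel. \<bar>a * F (t - x) + b * F (0 - x)\<bar> powr \<alpha>)"
    by (intro integral_lebesgue_eq_lborel) measurable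
  then have joint: "(CLINT w|M. iexp (a * J (\<lambda>x. F (t - x)) w + b * J (\<lambda>x. F (0 - x)) w))
      = of_real (exp (- (?I + \<bar>a\<bar> powr \<alpha> * ?N + \<bar>b\<bar> powr \<alpha> * ?N)))"
    unfolding char_pair[OF shift_L_space shift_L_space] by (simp only: integral_power_split[OF t])
  have marginal: "(CLINT w|M. iexp (e * J (\<lambda>x. F (s - x)) w)) = of_real (exp (- (\<bar>e\<bar> powr \<alpha>) * ?N))" for e s
  proof -
    have "(LINT x|lebesgue. \<bar>F (s - x)\<bar> powr \<alpha>) = (LINT x|lborel. \<bar>F (s - x)\<bar> powr \<alpha>)"
      by (intro integral_lebesgue_eq_lborel) measurable
    also have "\<dots> = ?N" by (rule integral_lborel_reflect)
    finally show ?thesis unfolding J_char[OF shift_L_space] by simp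
  qed
  have "exp (- (?I + \<bar>a\<bar> powr \<alpha> * ?N + \<bar>b\<bar> powr \<alpha> * ?N)) - exp (- (\<bar>a\<bar> powr \<alpha>) * ?N) * exp (- (\<bar>b\<bar> powr \<alpha>) * ?N)
      = exp (- (\<bar>a\<bar> powr \<alpha> + \<bar>b\<bar> powr \<alpha>) * ?N) * (exp (- ?I) - 1)"
  proof -
    have "- (?I + \<bar>a\<bar> powr \<alpha> * ?N + \<bar>b\<bar> powr \<alpha> * ?N) = (- (\<bar>a\<bar> powr \<alpha>) * ?N + - (\<bar>b\<bar> powr \<alpha>) * ?N) + - ?I"
      by simp
    moreover have "- (\<bar>a\<bar> powr \<alpha> + \<bar>b\<bar> powr \<alpha>) * ?N = - (\<bar>a\<bar> powr \<alpha>) * ?N + - (\<bar>b\<bar> powr \<alpha>) * ?N"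
      by (simp add: algebra_simps)
    ultimately show ?thesis by (simp only: exp_add right_diff_distrib mult_1_right)
  qed
  then show ?thesis
    unfolding dependence_def FIMA_eq joint marginal of_real_mult[symmetric] of_real_diff[symmetric]
    by (rule arg_cong)
qed

lemma dependence_FIMA_asymp:
  assumes a: "a \<noteq> 0" and b: "b \<noteq> 0"
  obtains c\<^sub>r where "0 < c\<^sub>r"
    "((\<lambda>t. norm (dependence M (FIMA J d g) a b t) * (t powr (\<alpha> * (1 - d) - 1) / c\<^sub>r)) \<longlongrightarrow> 1) at_top"
proof -
  let ?p = "\<lambda>t. t powr (\<alpha> * (1 - d) - 1)"
  let ?I = "\<lambda>t. LINT x|lborel. power_defect \<alpha> (a * F (t + x)) (b * F x)"
  define l where "l = (LINT y|lborel. limit_kernel a b y)"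
  define e where "e = exp (- (\<bar>a\<bar> powr \<alpha> + \<bar>b\<bar> powr \<alpha>) * (LINT x|lborel. \<bar>F x\<bar> powr \<alpha>))"
  \<comment> \<open>This product becomes the constant \<open>c\<^sub>r\<close>: \<open>e\<close> is
    the product of the marginal characteristic functions, and \<open>l\<close> is the limit of the
    scaled integral.\<close>
  have pos: "0 < e * \<bar>l\<bar>"
    using integral_limit_kernel_nonzero[OF a b] by (simp add: e_def l_def)
  have "filterlim (\<lambda>t. t powr e) at_top at_top" if "0 < e" for e :: real
    using that by real_asymp
  then have "filterlim ?p at_top at_top" using exponent by simp
  then have "((\<lambda>t. ?p t * (exp (- ?I t) - 1)) \<longlongrightarrow> - l) at_top"
    unfolding l_def by (rule tendsto_exp_diff_asymp[OF _ power_defect_integral_asymp])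
  then have "((\<lambda>t. e * \<bar>?p t * (exp (- ?I t) - 1)\<bar> / (e * \<bar>l\<bar>)) \<longlongrightarrow> e * \<bar>- l\<bar> / (e * \<bar>l\<bar>)) at_top"
    using pos by (intro tendsto_divide tendsto_mult tendsto_const tendsto_rabs) auto
  moreover have "e * \<bar>- l\<bar> / (e * \<bar>l\<bar>) = 1" using pos by auto
  moreover have "\<forall>\<^sub>F t in at_top. e * \<bar>?p t * (exp (- ?I t) - 1)\<bar> / (e * \<bar>l\<bar>)
      = norm (dependence M (FIMA J d g) a b t) * (?p t / (e * \<bar>l\<bar>))"
    using eventually_gt_at_top[of 0]
  proof eventually_elim
    case (elim t)
    have "norm (dependence M (FIMA J d g) a b t) = e * \<bar>exp (- ?I t) - 1\<bar>"
      unfolding dependence_FIMA[OF elim] norm_of_real e_def[symmetric] by (simp add: abs_mult e_def)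
    then show ?case by (simp add: abs_mult)
  qed
  ultimately have "((\<lambda>t. norm (dependence M (FIMA J d g) a b t) * (?p t / (e * \<bar>l\<bar>))) \<longlongrightarrow> 1) at_top"
    by (simp only: filterlim_cong[OF refl refl])
  with pos show thesis by (rule that)
qed

text \<open>The exponent involves only \<alpha> and d, so it can be fixed before the two
  frequencies; the constant is chosen afterwards.\<close>

lemma FIMA_long_range_dependent: "long_range_dependent M \<alpha> (FIMA J d g)"
  unfolding long_range_dependent_def
proof (intro conjI FIMA_SaS FIMA_stationary bexI allI impI)
  show "\<alpha> * (1 - d) - 1 \<in> {0<..<1}" using exponent by simp
  fix a b :: real
  assume "a \<noteq> 0" "b \<noteq> 0"
  then show "\<exists>c\<^sub>r>0. ((\<lambda>t. norm (dependence M (FIMA J d g) a b t) * (t powr (\<alpha> * (1 - d) - 1) / c\<^sub>r)) \<longlongrightarrow> 1) at_top"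
    using dependence_FIMA_asymp by metis
qed

end

theorem theorem4p4:
  fixes M :: "'w measure" and L :: "real \<Rightarrow> 'w \<Rightarrow> real"
    and J :: "(real \<Rightarrow> real) \<Rightarrow> 'w \<Rightarrow> real"
    and g :: "real \<Rightarrow> real" and C c \<alpha> d :: real
  assumes "stable_integral M \<alpha> L J"
    and "1 < \<alpha>" and "\<alpha> < 2" and "0 < d" and "d < 1 - 1 / \<alpha>"
    and "g \<in> borel_measurable lebesgue"
    and "\<And>t. t < 0 \<Longrightarrow> g t = 0"
    and "C > 0" and "c > 0" and "\<And>t. \<bar>g t\<bar> \<le> C * exp (- c * t)"
    and "(LINT t|lebesgue. g t) \<noteq> 0"
  shows "long_range_dependent M \<alpha> (FIMA J d g)"
proof -
  interpret stable_integral M \<alpha> L J by (rule assms(1))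
  have "1 / \<alpha> > 0" using assms(2) by simp
  then have "d < 1" using assms(5) by linarith
  then interpret fima M \<alpha> L J g C c d
    by unfold_locales (use assms in auto)
  show ?thesis by (rule FIMA_long_range_dependent)
qed

end
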